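(* Let $\mu=\prod_{j=1}^\infty|P_j|^2$ be a generalized Riesz product of class (L), where the $P_j$ are analytic trigonometric polynomials which are outer. Put $S_n=\prod_{j=1}^nP_j$ and $\phi_n=\frac{S_n}{|S_n|}$ (a function of absolute value one, defined a.e. on $S^1$). If the sequence $\phi_n$, $n=1,2,\dots$, admits a (subsequential) weak$*$ limit $\phi$ in $L^\infty(S^1,dz)$ which is non-vanishing a.e. $(dz)$ on the set $\{z:\frac{d\mu}{dz}>0\}$, then either $\mu$ is singular to Lebesgue measure, or its absolutely continuous part has positive Mahler measure, i.e. $\exp\left(\int_{S^1}\log\frac{d\mu}{dz}\,dz\right)>0$.
   Context: $S^1$ is the unit circle and $dz$ denotes normalized Lebesgue measure on $S^1$; $\frac{d\mu}{dz}$ denotes the density of the absolutely continuous part of $\mu$ with respect to $dz$. An analytic trigonometric polynomial is one of the form $\sum_{i=0}^m a_iz^i$ (taken here with positive constant term); it is outer if it has no zeros in the open unit disc. Generalized Riesz product: a sequence $P_1,P_2,\dots$ of trigonometric polynomials on $S^1$ is said to define a generalized Riesz product if (i) for every finite sequence $i_1<\dots<i_k$ of natural numbers, $\int_{S^1}|P_{i_1}\cdots P_{i_k}(z)|^2\,dz=1$; and (ii) for every infinite sequence $i_1<i_2<\cdots$ of natural numbers, the weak limit of the probability measures $|P_{i_1}\cdots P_{i_k}(z)|^2\,dz$ as $k\to\infty$ exists; this limit is denoted $\prod_{j=1}^\infty|P_{i_j}|^2$. The weak limit $\mu$ of $|P_1\cdots P_k|^2dz$ is the generalized Riesz product $\prod_{j=1}^\infty|P_j|^2$.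 Class (L): $\mu=\prod_{j=1}^\infty|P_j|^2$ is of class (L) if for each sequence $k_1<k_2<\cdots$ of natural numbers, the tail measures $\prod_{j=n+1}^\infty|P_{k_j}|^2$, $n=1,2,\dots$, converge weakly to the Lebesgue measure $dz$ as $n\to\infty$. *)

theory Defs
  imports "HOL-Analysis.Analysis" "HOL-Computational_Algebra.Polynomial"
begin

definition circle_lebesgue :: "complex measure" where
  "circle_lebesgue =
     distr (uniform_measure lborel {0..2 * pi}) (restrict_space borel (sphere 0 1)) cis"

lemma space_circle_lebesgue: "space circle_lebesgue = sphere 0 1"
  by (simp add: circle_lebesgue_def space_restrict_space)

lemma sets_circle_lebesgue: "sets circle_lebesgue = sets (restrict_space borel (sphere 0 1))"
  by (simp add: circle_lebesgue_def)

definition trig_polynomial :: "(complex \<Rightarrow> complex) \<Rightarrow> bool" where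
  "trig_polynomial f \<longleftrightarrow>
     (\<exists>(m::nat) (c::int \<Rightarrow> complex). \<forall>z\<in>sphere 0 1. f z = (\<Sum>k = - int m..int m. c k * z powi k))"

text \<open>A polynomial is regarded as an analytic trigonometric polynomial by evaluating it on the
  circle. Its constant term is required to be a positive real number.\<close>

definition positive_constant_term :: "complex poly \<Rightarrow> bool" where
  "positive_constant_term p \<longleftrightarrow> (\<exists>a::real. a > 0 \<and> coeff p 0 = complex_of_real a)"

definition outer_poly :: "complex poly \<Rightarrow> bool" where
  "outer_poly p \<longleftrightarrow> (\<forall>z\<in>ball 0 1. poly p z \<noteq> 0)"

definition finite_circle_measure :: "complex measure \<Rightarrow> bool" where
  "finite_circle_measure M \<longleftrightarrow>
     finite_measure M \<and> sets M = sets (restrict_space borel (sphere 0 1))"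

definition weakly_converges :: "(nat \<Rightarrow> complex measure) \<Rightarrow> complex measure \<Rightarrow> bool" where
  "weakly_converges M N \<longleftrightarrow>
     (\<forall>f::complex \<Rightarrow> real. continuous_on (sphere 0 1) f \<longrightarrow>
        (\<lambda>n. \<integral>z. f z \<partial>M n) \<longlonglongrightarrow> (\<integral>z. f z \<partial>N))"

definition partial_product_measure :: "(nat \<Rightarrow> complex \<Rightarrow> complex) \<Rightarrow> nat \<Rightarrow> complex measure" where
  "partial_product_measure Q n =
     density circle_lebesgue (\<lambda>z. ennreal ((cmod (\<Prod>j<n. Q j z))\<^sup>2))"

text \<open>\<^term>\<open>is_product_measure Q \<nu>\<close> says that the weak limit denoted by the infinite product of
  the squared moduli of the \<open>Q j\<close> exists and is \<open>\<nu>\<close>. All sequences are indexed from \<open>0\<close>.\<close>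

definition is_product_measure :: "(nat \<Rightarrow> complex \<Rightarrow> complex) \<Rightarrow> complex measure \<Rightarrow> bool" where
  "is_product_measure Q \<nu> \<longleftrightarrow>
     finite_circle_measure \<nu> \<and> weakly_converges (partial_product_measure Q) \<nu>"

definition defines_generalized_riesz_product :: "(nat \<Rightarrow> complex \<Rightarrow> complex) \<Rightarrow> bool" where
  "defines_generalized_riesz_product P \<longleftrightarrow>
     (\<forall>j. trig_polynomial (P j)) \<and>
     (\<forall>I. finite I \<longrightarrow> (\<integral>z. (cmod (\<Prod>i\<in>I. P i z))\<^sup>2 \<partial>circle_lebesgue) = 1) \<and>
     (\<forall>k. strict_mono k \<longrightarrow> (\<exists>\<nu>. is_product_measure (\<lambda>j. P (k j)) \<nu>))"

definition generalized_riesz_product ::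
    "(nat \<Rightarrow> complex \<Rightarrow> complex) \<Rightarrow> complex measure \<Rightarrow> bool" where
  "generalized_riesz_product P \<mu> \<longleftrightarrow>
     defines_generalized_riesz_product P \<and> is_product_measure P \<mu>"

text \<open>The tail measures \<open>\<nu> n\<close> below exist for a generalized Riesz product, and they are unique
  because a finite Borel measure on the circle is determined by the integrals of continuous
  functions.\<close>

definition class_L :: "(nat \<Rightarrow> complex \<Rightarrow> complex) \<Rightarrow> bool" where
  "class_L P \<longleftrightarrow>
     (\<forall>k \<nu>. strict_mono k \<longrightarrow> (\<forall>n. is_product_measure (\<lambda>j. P (k (n + j))) (\<nu> n)) \<longrightarrow>
        weakly_converges \<nu> circle_lebesgue)"

definition mutually_singular :: "'a measure \<Rightarrow> 'a measure \<Rightarrow> bool" where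
  "mutually_singular M N \<longleftrightarrow>
     sets M = sets N \<and> (\<exists>A\<in>sets M. emeasure M A = 0 \<and> emeasure N (space N - A) = 0)"

text \<open>\<open>h\<close> is a version of the density, with respect to \<open>M\<close>, of the absolutely continuous part in
  the Lebesgue decomposition of \<open>N\<close>. The constant \<open>RN_deriv\<close> is of no use here, since
  \<open>N\<close> need not be absolutely continuous.\<close>

definition is_ac_density :: "'a measure \<Rightarrow> 'a measure \<Rightarrow> ('a \<Rightarrow> ennreal) \<Rightarrow> bool" where
  "is_ac_density M N h \<longleftrightarrow>
     h \<in> borel_measurable M \<and> sets N = sets M \<and>
     (\<exists>N\<^sub>s. mutually_singular M N\<^sub>s \<and>
        (\<forall>A\<in>sets M. emeasure N A = emeasure (density M h) A + emeasure N\<^sub>s A))"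

definition ext_ln :: "ennreal \<Rightarrow> ereal" where
  "ext_ln x = (if x = 0 then - \<infinity> else if x = \<infinity> then \<infinity> else ereal (ln (enn2real x)))"

definition ext_exp :: "ereal \<Rightarrow> ennreal" where
  "ext_exp x = (case x of ereal r \<Rightarrow> ennreal (exp r) | PInfty \<Rightarrow> \<infinity> | MInfty \<Rightarrow> 0)"

text \<open>The constant \<open>e2ennreal\<close> sends negative numbers to \<open>0\<close>, so the two terms are the integrals of
  the positive and the negative part. The first one is finite when \<open>f\<close> is the logarithm of
  an integrable function, so that \<open>\<infinity> - \<infinity>\<close> does not arise for the Mahler measure of such a
  function.\<close>

definition ext_integral :: "'a measure \<Rightarrow> ('a \<Rightarrow> ereal) \<Rightarrow> ereal" where
  "ext_integral M f =
     enn2ereal (\<integral>\<^sup>+x. e2ennreal (f x) \<partial>M) - enn2ereal (\<integral>\<^sup>+x. e2ennreal (- f x) \<partial>M)"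

definition mahler_measure :: "(complex \<Rightarrow> ennreal) \<Rightarrow> ennreal" where
  "mahler_measure h = ext_exp (ext_integral circle_lebesgue (\<lambda>z. ext_ln (h z)))"

definition in_Linfty :: "'a measure \<Rightarrow> ('a \<Rightarrow> complex) \<Rightarrow> bool" where
  "in_Linfty M f \<longleftrightarrow> f \<in> borel_measurable M \<and> (\<exists>C::real. AE x in M. cmod (f x) \<le> C)"

definition weak_star_converges :: "'a measure \<Rightarrow> (nat \<Rightarrow> 'a \<Rightarrow> complex) \<Rightarrow> ('a \<Rightarrow> complex) \<Rightarrow> bool" where
  "weak_star_converges M F f \<longleftrightarrow>
     (\<forall>n. in_Linfty M (F n)) \<and> in_Linfty M f \<and>
     (\<forall>g::'a \<Rightarrow> complex. integrable M g \<longrightarrow>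
        (\<lambda>n. \<integral>x. F n x * g x \<partial>M) \<longlonglongrightarrow> (\<integral>x. f x * g x \<partial>M))"

text \<open>The phase of the product of the first \<open>n\<close> polynomials, with value \<open>0\<close> (since \<open>0 / 0 = 0\<close>) at
  the finitely many zeros of that product.\<close>

definition phase :: "(nat \<Rightarrow> complex poly) \<Rightarrow> nat \<Rightarrow> complex \<Rightarrow> complex" where
  "phase P n z = (\<Prod>j<n. poly (P j) z) / complex_of_real (cmod (\<Prod>j<n. poly (P j) z))"

end

theory Submission
  imports Defs "HOL-Complex_Analysis.Complex_Analysis"
begin

text \<open>Let \<open>S\<^sub>n\<close> be the partial products, \<open>h\<close> the density of the absolutely continuous part of \<open>\<mu>\<close> and
  \<open>w = sqrt h\<close>. The proof is a dichotomy on the constant terms \<open>S\<^sub>n(0)\<close>, which are positive and decrease because the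
  constant term of a polynomial of \<open>L\<^sup>2\<close> norm \<open>1\<close> is at most \<open>1\<close> in modulus.

  Suppose that they stay above some \<open>\<beta> > 0\<close>. Since \<open>S\<^sub>n\<close> has no zeros in the disc, the mean of
  \<open>ln \<bar>S\<^sub>n\<bar>\<^sup>2\<close> on the circle is at least \<open>2 ln \<beta>\<close>. The functional \<open>\<integral> ln\<close> is upper semicontinuous under weak
  convergence: \<open>ln x \<le> \<theta> x - 1 - ln \<theta>\<close> for every \<open>\<theta> > 0\<close>, and for a fixed continuous \<open>\<theta>\<close> the
  right-hand side is stable under the weak limit. Hence \<open>ln h\<close> has a finite integral over the set where it is negative
  (\<open>mahler_measure_pos_if_constant_terms_bounded\<close>).

  Suppose that they tend to \<open>0\<close>. By Montel's and Hurwitz' theorems a subsequence of the \<open>S\<^sub>n\<close> tends to \<open>0\<close> locally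
  uniformly in the disc, so that all its Fourier coefficients tend to \<open>0\<close>
  (\<open>outer_poly_coeffs_tendsto_0\<close>). On the other hand class (L) implies that \<open>\<bar>S\<^sub>n\<bar>\<close> converges to \<open>w\<close> in
  \<open>L\<^sup>1\<close> (\<open>partial_product_converges_in_mean\<close>): the density of the tail after \<open>n\<close> factors is \<open>u\<^sub>n\<^sup>2\<close>
  with \<open>u\<^sub>n = w / \<bar>S\<^sub>n\<bar>\<close>, semicontinuity bounds the upper limits of \<open>\<integral> \<bar>S\<^sub>n\<bar>\<close> and of \<open>\<integral> w u\<^sub>n\<close>
  by \<open>\<integral> w\<close>, and adding the two bounds makes
  \<open>\<integral> \<bar>S\<^sub>n\<bar> (1 - u\<^sub>n)\<^sup>2 = \<integral> \<bar>S\<^sub>n\<bar> + \<integral> w u\<^sub>n - 2 \<integral> w\<close> tend to \<open>0\<close>. As \<open>S\<^sub>n = \<phi>\<^sub>n \<bar>S\<^sub>n\<bar>\<close>, the product of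
  a weak-star and a norm convergent sequence, the Fourier coefficients of \<open>S\<^sub>n\<close> converge to those of
  \<open>\<phi> w\<close>. Therefore \<open>\<phi> w = 0\<close> almost everywhere, and since \<open>\<phi>\<close> does not vanish where \<open>h > 0\<close>,
  the density \<open>h\<close> is zero and \<open>\<mu>\<close> is singular.\<close>


section \<open>Integration on the circle\<close>

lemma finite_circle_measureD:
  assumes "finite_circle_measure M"
  shows "finite_measure M" "sets M = sets (restrict_space borel (sphere 0 1))"
    "space M = sphere 0 1"
proof -
  show "finite_measure M" and s: "sets M = sets (restrict_space borel (sphere 0 1))"
    using assms by (auto simp: finite_circle_measure_def)
  show "space M = sphere 0 1"
    using sets_eq_imp_space_eq[OF s] by (simp add: space_restrict_space)
qed

lemma borel_measurable_circle_continuous: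
  fixes f :: "complex \<Rightarrow> 'b::topological_space"
  assumes "sets M = sets (restrict_space borel (sphere 0 1))" "continuous_on (sphere 0 1) f"
  shows "f \<in> borel_measurable M"
  using borel_measurable_continuous_on_restrict[OF assms(2)] measurable_cong_sets[OF assms(1) refl]
  by blast

lemma integrable_circle_continuous:
  fixes f :: "complex \<Rightarrow> 'b::{banach, second_countable_topology}"
  assumes "finite_circle_measure M" "continuous_on (sphere 0 1) f"
  shows "integrable M f"
proof -
  interpret finite_measure M using finite_circle_measureD[OF assms(1)] by simp
  have "compact (f ` sphere 0 1)"
    using assms(2) by (intro compact_continuous_image) auto
  then obtain B where "\<And>z. z \<in> sphere 0 1 \<Longrightarrow> norm (f z) \<le> B"
    using compact_imp_bounded bounded_iff by (metis image_eqI)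
  then show ?thesis
    by (intro integrable_const_bound[where B = B])
      (auto simp: finite_circle_measureD[OF assms(1)]
        intro!: borel_measurable_circle_continuous[OF _ assms(2)])
qed

lemma cis_measurable_circle:
  "cis \<in> measurable lborel (restrict_space borel (sphere 0 1))"
  by (intro measurable_restrict_space2)
    (auto intro!: borel_measurable_continuous_onI continuous_intros)

lemma emeasure_space_circle_lebesgue: "emeasure circle_lebesgue (space circle_lebesgue) = 1"
proof -
  have "cis \<in> measurable (uniform_measure lborel {0..2*pi}) (restrict_space borel (sphere 0 1))"
    using cis_measurable_circle by (simp cong: measurable_cong_sets)
  moreover have "emeasure (uniform_measure lborel {0..2*pi}) UNIV = 1"
    by (subst emeasure_uniform_measure)
      (auto simp: divide_ennreal)
  moreover have "cis -` sphere 0 1 = UNIV" by auto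
  moreover have "sphere 0 1 \<in> sets (restrict_space borel (sphere 0 1 :: complex set))"
    by (subst sets_restrict_space_iff) auto
  ultimately show ?thesis
    unfolding space_circle_lebesgue unfolding circle_lebesgue_def
    by (simp add: emeasure_distr)
qed

lemma finite_circle_measure_circle_lebesgue: "finite_circle_measure circle_lebesgue"
  by (auto simp: finite_circle_measure_def sets_circle_lebesgue emeasure_space_circle_lebesgue
      intro!: finite_measureI)

lemmas circle_integrable = integrable_circle_continuous[OF finite_circle_measure_circle_lebesgue]

interpretation circle_lebesgue: finite_measure circle_lebesgue
  using finite_circle_measureD(1)[OF finite_circle_measure_circle_lebesgue] .

lemma measure_space_circle_lebesgue [simp]: "measure circle_lebesgue (space circle_lebesgue) = 1"
  by (simp add: measure_def emeasure_space_circle_lebesgue)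

lemma integral_circle_lebesgue:
  fixes f :: "complex \<Rightarrow> complex"
  assumes "continuous_on (sphere 0 1) f"
  shows "(\<integral>z. f z \<partial>circle_lebesgue) = integral {0..2*pi} (\<lambda>t. f (cis t)) / (2*pi)"
proof -
  have m: "f \<in> borel_measurable (restrict_space borel (sphere 0 1))"
    by (rule borel_measurable_circle_continuous[OF refl assms])
  have c: "continuous_on {0..2*pi} (\<lambda>t. f (cis t))"
    by (rule continuous_on_compose2[OF assms]) (auto intro!: continuous_intros)
  have mc: "(\<lambda>t. f (cis t)) \<in> borel_measurable lborel"
    using measurable_compose[OF cis_measurable_circle m] by simp
  have u: "uniform_measure lborel {0..2*pi}
      = density lborel (\<lambda>t. ennreal (indicator {0..2*pi} t / (2*pi)))"
    unfolding uniform_measure_def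
    by (intro density_cong) (auto simp: indicator_def divide_ennreal ennreal_1[symmetric] simp del: ennreal_1)
  have "(\<integral>z. f z \<partial>circle_lebesgue) = (\<integral>t. f (cis t) \<partial>uniform_measure lborel {0..2*pi})"
    unfolding circle_lebesgue_def
    by (rule integral_distr) (use cis_measurable_circle m in \<open>simp_all cong: measurable_cong_sets\<close>)
  also have "\<dots> = (\<integral>t. (indicator {0..2*pi} t / (2*pi)) *\<^sub>R f (cis t) \<partial>lborel)"
    unfolding u by (rule integral_density) (use mc in auto)
  also have "\<dots> = (\<integral>t. (1/(2*pi)) *\<^sub>R (indicator {0..2*pi} t *\<^sub>R f (cis t)) \<partial>lborel)"
    by (intro Bochner_Integration.integral_cong) auto
  also have "\<dots> = (1/(2*pi)) *\<^sub>R (\<integral>t. indicator {0..2*pi} t *\<^sub>R f (cis t) \<partial>lborel)"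
    by (rule Bochner_Integration.integral_scaleR_right)
  also have "(\<integral>t. indicator {0..2*pi} t *\<^sub>R f (cis t) \<partial>lborel) = integral {0..2*pi} (\<lambda>t. f (cis t))"
    using set_borel_integral_eq_integral(2)[OF borel_integrable_atLeastAtMost'[OF c]]
    by (simp add: set_lebesgue_integral_def)
  finally show ?thesis by (simp add: scaleR_conv_of_real)
qed

lemma circle_lebesgue_singleton:
  assumes "a \<in> sphere 0 1"
  shows "emeasure circle_lebesgue {a} = 0"
proof -
  have sub: "{t \<in> {0..2*pi}. cis t = a} \<subseteq> {Arg2pi a, 2*pi}"
  proof
    fix t assume t: "t \<in> {t \<in> {0..2*pi}. cis t = a}"
    show "t \<in> {Arg2pi a, 2*pi}"
    proof (cases "t = 2*pi")
      case False
      then have "Arg2pi (of_real 1 * exp (\<i> * of_real t)) = t"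
        using t by (intro Arg2pi_unique[where r = 1]) auto
      then show ?thesis using t by (auto simp: cis_conv_exp)
    qed auto
  qed
  have sa: "{a} \<in> sets (restrict_space borel (sphere 0 1))"
    using assms by (subst sets_restrict_space_iff) auto
  have m: "cis \<in> measurable (uniform_measure lborel {0..2*pi}) (restrict_space borel (sphere 0 1))"
    using cis_measurable_circle by (simp cong: measurable_cong_sets)
  have v: "cis -` {a} \<in> sets lborel"
    using measurable_sets[OF cis_measurable_circle sa] by simp
  have "emeasure lborel ({0..2*pi} \<inter> cis -` {a}) = 0"
    by (rule emeasure_lborel_countable[OF countable_subset[of _ "{Arg2pi a, 2*pi}"]])
      (use sub in auto)
  then show ?thesis
    unfolding circle_lebesgue_def by (subst emeasure_distr[OF m sa]) (use v in simp)
qed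

lemma AE_circle_poly_nonzero:
  assumes "p \<noteq> 0"
  shows "AE z in circle_lebesgue. poly p z \<noteq> 0"
proof -
  have "AE z in circle_lebesgue. \<forall>a\<in>{z\<in>sphere 0 1. poly p z = 0}. z \<noteq> a"
  proof (rule AE_finite_allI)
    show "finite {z\<in>sphere 0 1. poly p z = 0}"
      by (rule finite_subset[OF _ poly_roots_finite[OF assms]]) auto
    fix a assume "a \<in> {z\<in>sphere 0 1. poly p z = 0}"
    then have a: "a \<in> sphere 0 1" by simp
    have "{a} \<in> null_sets circle_lebesgue"
      using circle_lebesgue_singleton[OF a] a
      by (auto simp: null_sets_def sets_circle_lebesgue sets_restrict_space_iff)
    from AE_not_in[OF this] show "AE z in circle_lebesgue. z \<noteq> a" by simp
  qed
  then show ?thesis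
    by (rule AE_mp) (auto intro!: AE_I2 simp: space_circle_lebesgue)
qed

text \<open>This mean value property is the only source of explicit integrals in what follows: the
  orthogonality of the monomials and Jensen's inequality both come from it.\<close>

lemma integral_circle_holomorphic:
  assumes "f holomorphic_on cball 0 1"
  shows "(\<integral>z. f z \<partial>circle_lebesgue) = f 0"
proof -
  have "((\<lambda>u. f u / (u - 0)) has_contour_integral (2 * of_real pi * \<i> * f 0)) (circlepath 0 1)"
    by (rule Cauchy_integral_circlepath_simple[OF assms]) simp
  then have "((\<lambda>t. f (cis t) / cis t * \<i> * cis t) has_integral 2 * of_real pi * \<i> * f 0) {0..2*pi}"
    unfolding circlepath_def by (subst (asm) has_contour_integral_part_circlepath_iff) auto
  then have "((\<lambda>t. (1/\<i>) * (f (cis t) / cis t * \<i> * cis t)) has_integral (1/\<i>) * (2 * of_real pi * \<i> * f 0)) {0..2*pi}"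
    by (rule has_integral_mult_right)
  then have "((\<lambda>t. f (cis t)) has_integral 2 * of_real pi * f 0) {0..2*pi}"
    by (simp add: field_simps)
  then have "integral {0..2*pi} (\<lambda>t. f (cis t)) = 2 * of_real pi * f 0"
    by (rule integral_unique)
  moreover have "continuous_on (sphere 0 1) f"
    using holomorphic_on_imp_continuous_on[OF assms] by (rule continuous_on_subset) auto
  ultimately show ?thesis
    by (simp add: integral_circle_lebesgue)
qed

lemma circle_power_eq_powi:
  fixes z :: complex
  assumes "z \<in> sphere 0 1" shows "cnj z ^ k = z powi (- int k)"
proof -
  have "z * cnj z = 1" using assms by (simp add: complex_norm_square[symmetric])
  then have "cnj z = inverse z" by (metis inverse_unique)
  then show ?thesis by (simp add: power_int_minus power_inverse)
qed

lemma integral_circle_powi: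
  "(\<integral>z. z powi k \<partial>circle_lebesgue) = (if k = 0 then 1 else 0)"
proof (cases "k \<ge> 0")
  case True
  then have "(\<integral>z. z powi k \<partial>circle_lebesgue) = (\<integral>z. z ^ nat k \<partial>circle_lebesgue)"
    by (simp add: power_int_def)
  also have "\<dots> = 0 ^ nat k"
    by (rule integral_circle_holomorphic) (intro holomorphic_intros)
  finally show ?thesis using True by (auto simp: power_0_left)
next
  case False
  define m where "m = nat (- k)"
  have m: "k = - int m" "m > 0" using False by (auto simp: m_def)
  have "(\<integral>z. z powi k \<partial>circle_lebesgue) = (\<integral>z. cnj (z ^ m) \<partial>circle_lebesgue)"
    by (intro Bochner_Integration.integral_cong refl)
      (simp only: m(1) space_circle_lebesgue complex_cnj_power circle_power_eq_powi)
  also have "\<dots> = cnj (\<integral>z. z ^ m \<partial>circle_lebesgue)"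
    by (rule Bochner_Integration.integral_cnj)
  also have "(\<integral>z. z ^ m \<partial>circle_lebesgue) = 0 ^ m"
    by (rule integral_circle_holomorphic) (intro holomorphic_intros)
  finally show ?thesis using m by simp
qed

lemma integral_circle_poly_powi:
  "(\<integral>z. poly p z * z powi k \<partial>circle_lebesgue) = (if k \<le> 0 then coeff p (nat (- k)) else 0)"
proof -
  have i: "integrable circle_lebesgue (\<lambda>z. z powi j)" for j
    by (rule circle_integrable) (auto intro!: continuous_intros)
  have "(\<integral>z. poly p z * z powi k \<partial>circle_lebesgue)
      = (\<integral>z. (\<Sum>i\<le>degree p. coeff p i * z powi (int i + k)) \<partial>circle_lebesgue)"
  proof (intro Bochner_Integration.integral_cong refl)
    fix z assume "z \<in> space circle_lebesgue"
    then have "z \<noteq> 0" by (auto simp: space_circle_lebesgue)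
    then show "poly p z * z powi k = (\<Sum>i\<le>degree p. coeff p i * z powi (int i + k))"
      by (simp add: poly_altdef sum_distrib_right power_int_add mult.assoc)
  qed
  also have "\<dots> = (\<Sum>i\<le>degree p. coeff p i * (if int i + k = 0 then 1 else 0))"
    by (simp add: i integral_circle_powi)
  also have "\<dots> = (if k \<le> 0 then coeff p (nat (- k)) else 0)"
  proof (cases "k \<le> 0")
    case True
    then have "(\<Sum>i\<le>degree p. coeff p i * (if int i + k = 0 then 1 else 0))
      = (\<Sum>i\<le>degree p. if i = nat (- k) then coeff p i else 0)"
      by (intro sum.cong refl) auto
    then show ?thesis using True by (simp add: coeff_eq_0)
  qed auto
  finally show ?thesis .
qed


section \<open>Approximation by continuous functions\<close>

lemma open_superset_measure_less:
  fixes M :: "'a::{second_countable_topology, complete_space} measure"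
  assumes "finite_measure M" "sets M = sets borel" "A \<in> sets borel" "e > 0"
  obtains U where "open U" "A \<subseteq> U" "measure M (U - A) < e"
proof -
  interpret finite_measure M by fact
  have "emeasure M A < emeasure M A + ennreal e"
    using assms(4) by (simp add: emeasure_eq_measure ennreal_less_iff flip: ennreal_plus)
  then have "(INF U\<in>{U. A \<subseteq> U \<and> open U}. emeasure M U) < emeasure M A + ennreal e"
    using outer_regular[of M A] assms by simp
  then obtain U where U: "A \<subseteq> U" "open U" "emeasure M U < emeasure M A + ennreal e"
    by (auto simp: INF_less_iff)
  have "measure M U < measure M A + e"
    using U(3) assms(4) by (simp add: emeasure_eq_measure ennreal_less_iff flip: ennreal_plus)
  moreover have "measure M (U - A) = measure M U - measure M A"
    using U assms by (intro finite_measure_Diff) auto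
  ultimately show ?thesis using that U by auto
qed

lemma indicator_L1_approx_continuous:
  fixes M N :: "'a::euclidean_space measure"
  assumes M: "finite_measure M" "sets M = sets borel"
    and N: "finite_measure N" "sets N = sets borel"
    and A: "A \<in> sets borel" and e: "e > 0"
  obtains \<theta> :: "'a \<Rightarrow> real" where "continuous_on UNIV \<theta>" "\<And>x. 0 \<le> \<theta> x \<and> \<theta> x \<le> 1"
    "(\<integral>x. \<bar>indicator A x - \<theta> x\<bar> \<partial>M) < e" "(\<integral>x. \<bar>indicator A x - \<theta> x\<bar> \<partial>N) < e"
proof -
  have cA: "- A \<in> sets borel" using A by auto
  have e2: "e / 2 > 0" using e by simp
  obtain U1 where U1: "open U1" "A \<subseteq> U1" "measure M (U1 - A) < e/2"
    using open_superset_measure_less[OF M A e2] .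
  obtain U2 where U2: "open U2" "A \<subseteq> U2" "measure N (U2 - A) < e/2"
    using open_superset_measure_less[OF N A e2] .
  obtain V1 where V1: "open V1" "- A \<subseteq> V1" "measure M (V1 - - A) < e/2"
    using open_superset_measure_less[OF M cA e2] .
  obtain V2 where V2: "open V2" "- A \<subseteq> V2" "measure N (V2 - - A) < e/2"
    using open_superset_measure_less[OF N cA e2] .
  define U where "U = U1 \<inter> U2"
  define V where "V = V1 \<inter> V2"
  have o: "open U" "open V" "A \<subseteq> U" "- A \<subseteq> V"
    using U1 U2 V1 V2 by (auto simp: U_def V_def)
  obtain \<theta> :: "'a \<Rightarrow> real" where \<theta>: "continuous_on UNIV \<theta>" "\<And>x. \<theta> x \<in> closed_segment 0 1"
      "\<And>x. x \<in> - U \<Longrightarrow> \<theta> x = 0" "\<And>x. x \<in> - V \<Longrightarrow> \<theta> x = 1"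
    by (rule Urysohn[of "- U" "- V" "0::real" 1]) (use o in auto)
  have r: "0 \<le> \<theta> x \<and> \<theta> x \<le> 1" for x using \<theta>(2)[of x] by (auto simp: closed_segment_eq_real_ivl)
  have small: "(\<integral>x. \<bar>indicator A x - \<theta> x\<bar> \<partial>L) < e"
    if L: "finite_measure L" "sets L = sets borel"
      and s: "measure L (U - A) < e/2" "measure L (V - - A) < e/2" for L
  proof -
    interpret finite_measure L by fact
    have ms: "\<theta> \<in> borel_measurable L"
      using borel_measurable_continuous_onI[OF \<theta>(1)] measurable_cong_sets[OF L(2) refl] by blast
    have [measurable]: "A \<in> sets L" "U \<in> sets L" "V \<in> sets L" using L A o by auto
    have "\<bar>indicator A x - \<theta> x\<bar> \<le> 1" for x
      using r[of x] by (auto simp: indicator_def)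
    then have i: "integrable L (\<lambda>x. indicator A x - \<theta> x)"
      by (intro integrable_const_bound[where B = 1]) (use ms in auto)
    have "(\<integral>x. \<bar>indicator A x - \<theta> x\<bar> \<partial>L)
        \<le> (\<integral>x. indicator (U - A) x + indicator (V - - A) x \<partial>L)"
    proof (rule integral_mono)
      fix x
      show "\<bar>indicator A x - \<theta> x\<bar> \<le> (indicator (U - A) x + indicator (V - - A) x :: real)"
        using r[of x] \<theta>(3,4)[of x] by (auto simp: indicator_def)
    qed (use i in \<open>auto intro!: integrable_add integrable_real_indicator simp: emeasure_eq_measure\<close>)
    also have "\<dots> = measure L (U - A) + measure L (V - - A)"
      by (subst Bochner_Integration.integral_add)
        (auto intro!: integrable_real_indicator simp: emeasure_eq_measure)
    finally show ?thesis using s by simp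
  qed
  have mono: "measure L X \<le> measure L Y" if "finite_measure L" "sets L = sets borel" "X \<subseteq> Y" "Y \<in> sets borel"
    for L and X Y :: "'a set"
    using that by (intro finite_measure.finite_measure_mono) auto
  show ?thesis
  proof (rule that[OF \<theta>(1) r])
    show "(\<integral>x. \<bar>indicator A x - \<theta> x\<bar> \<partial>M) < e"
    proof (rule small[OF M])
      show "measure M (U - A) < e/2"
        by (rule le_less_trans[OF mono[OF M, of _ "U1 - A"] U1(3)]) (use U1 A in \<open>auto simp: U_def\<close>)
      show "measure M (V - - A) < e/2"
        by (rule le_less_trans[OF mono[OF M, of _ "V1 - - A"] V1(3)]) (use V1 A in \<open>auto simp: V_def\<close>)
    qed
    show "(\<integral>x. \<bar>indicator A x - \<theta> x\<bar> \<partial>N) < e"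
    proof (rule small[OF N])
      show "measure N (U - A) < e/2"
        by (rule le_less_trans[OF mono[OF N, of _ "U2 - A"] U2(3)]) (use U2 A in \<open>auto simp: U_def\<close>)
      show "measure N (V - - A) < e/2"
        by (rule le_less_trans[OF mono[OF N, of _ "V2 - - A"] V2(3)]) (use V2 A in \<open>auto simp: V_def\<close>)
    qed
  qed
qed

text \<open>One continuous function has to serve two measures at once: below they are Lebesgue measure and
  a measure that need not be absolutely continuous.\<close>

lemma bounded_L1_approx_continuous:
  fixes M N :: "'a::euclidean_space measure" and g :: "'a \<Rightarrow> real"
  assumes M: "finite_measure M" "sets M = sets borel"
    and N: "finite_measure N" "sets N = sets borel"
    and g: "g \<in> borel_measurable borel" "\<And>x. a \<le> g x \<and> g x \<le> b" and e: "e > 0"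
  obtains \<theta> :: "'a \<Rightarrow> real" where "continuous_on UNIV \<theta>" "\<And>x. a \<le> \<theta> x \<and> \<theta> x \<le> b"
    "(\<integral>x. \<bar>g x - \<theta> x\<bar> \<partial>M) < e" "(\<integral>x. \<bar>g x - \<theta> x\<bar> \<partial>N) < e"
proof -
  define T where "T = measure M UNIV + measure N UNIV"
  have T: "T \<ge> 0" by (simp add: T_def)
  obtain n :: nat where "real n > max 0 (2 * T / e)"
    using reals_Archimedean2 by blast
  then have n: "n > 0" "real n > 2 * T / e" by auto
  define J where "J = {\<lfloor>n * a\<rfloor>..\<lfloor>n * b\<rfloor>}"
  define A where "A j = {x. \<lfloor>n * g x\<rfloor> = j}" for j
  define s where "s x = (\<Sum>j\<in>J. (j / n) * indicator (A j) x)" for x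
  have s_eq: "s x = \<lfloor>n * g x\<rfloor> / n" for x
  proof -
    have "\<lfloor>n * g x\<rfloor> \<in> J" using g(2)[of x] n by (auto simp: J_def intro!: floor_mono)
    moreover have "s x = (\<Sum>j\<in>J. if j = \<lfloor>n * g x\<rfloor> then j / n else 0)"
      unfolding s_def A_def by (intro sum.cong) (auto simp: indicator_def)
    ultimately show ?thesis by (simp add: J_def)
  qed
  have gs: "\<bar>g x - s x\<bar> \<le> 1 / n" for x
  proof -
    have "\<bar>n * g x - \<lfloor>n * g x\<rfloor>\<bar> \<le> 1" by linarith
    moreover have "g x - s x = (n * g x - \<lfloor>n * g x\<rfloor>) / n"
      using n by (simp add: s_eq field_simps)
    ultimately show ?thesis using n by (simp add: divide_right_mono)
  qed
  define C where "C = (\<Sum>j\<in>J. \<bar>j / n\<bar>) + 1"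
  have C: "C > 0" by (auto simp: C_def intro!: add_nonneg_pos sum_nonneg)
  have Am[measurable]: "A j \<in> sets borel" for j
    unfolding A_def using g(1) by measurable
  have eC: "e / (2 * C) > 0" using e C by simp
  define Q where "Q j \<theta> \<longleftrightarrow> continuous_on UNIV \<theta> \<and> (\<forall>x. 0 \<le> \<theta> x \<and> \<theta> x \<le> 1) \<and>
    (\<integral>x. \<bar>indicator (A j) x - \<theta> x\<bar> \<partial>M) < e / (2 * C) \<and>
    (\<integral>x. \<bar>indicator (A j) x - \<theta> x\<bar> \<partial>N) < e / (2 * C)" for j and \<theta> :: "'a \<Rightarrow> real"
  have "\<exists>\<theta>. Q j \<theta>" for j
    unfolding Q_def by (rule indicator_L1_approx_continuous[OF M N Am[of j] eC]) blast
  then obtain \<theta> where "\<And>j. Q j (\<theta> j)" by metis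
  then have \<theta>: "\<And>j. continuous_on UNIV (\<theta> j)" "\<And>j x. 0 \<le> \<theta> j x \<and> \<theta> j x \<le> (1::real)"
    "\<And>j. (\<integral>x. \<bar>indicator (A j) x - \<theta> j x\<bar> \<partial>M) < e / (2 * C)"
    "\<And>j. (\<integral>x. \<bar>indicator (A j) x - \<theta> j x\<bar> \<partial>N) < e / (2 * C)" by (simp_all add: Q_def)
  define t where "t x = (\<Sum>j\<in>J. (j / n) * \<theta> j x)" for x
  have t: "continuous_on UNIV t" unfolding t_def by (intro continuous_intros \<theta>(1))
  define u where "u x = max a (min b (t x))" for x
  have u: "continuous_on UNIV u" unfolding u_def
    by (intro continuous_on_max continuous_on_min continuous_on_const t)
  have ab: "a \<le> b" using g(2)[of undefined] by linarith
  have uab: "a \<le> u x \<and> u x \<le> b" for x using ab by (simp add: u_def)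
  have gu: "\<bar>g x - u x\<bar> \<le> \<bar>g x - t x\<bar>" for x
    using g(2)[of x] by (auto simp: u_def max_def min_def)
  have small: "(\<integral>x. \<bar>g x - u x\<bar> \<partial>L) < e"
    if L: "finite_measure L" "sets L = sets borel" "measure L UNIV \<le> T"
      and s: "\<And>j. (\<integral>x. \<bar>indicator (A j) x - \<theta> j x\<bar> \<partial>L) < e / (2 * C)" for L
  proof -
    interpret finite_measure L by fact
    have spL: "space L = UNIV" using sets_eq_imp_space_eq[OF L(2)] by simp
    have cm: "f \<in> borel_measurable L" if "f \<in> borel_measurable borel" for f :: "'a \<Rightarrow> real"
      using that measurable_cong_sets[OF L(2) refl] by blast
    have \<theta>m: "\<theta> j \<in> borel_measurable L" for j
      by (intro cm borel_measurable_continuous_onI \<theta>(1))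
    have um: "u \<in> borel_measurable L" by (intro cm borel_measurable_continuous_onI u)
    have gm: "g \<in> borel_measurable L" by (intro cm g)
    have Aj[measurable]: "A j \<in> sets L" for j using L by simp
    have "\<bar>indicator (A j) x - \<theta> j x\<bar> \<le> 1" for j x
      using \<theta>(2)[of j x] by (auto simp: indicator_def)
    then have i1: "integrable L (\<lambda>x. indicator (A j) x - \<theta> j x)" for j
      by (intro integrable_const_bound[where B = 1]) (use \<theta>m in auto)
    have gb: "\<bar>g x\<bar> \<le> \<bar>a\<bar> + \<bar>b\<bar>" for x using g(2)[of x] by linarith
    have ig: "integrable L g"
      by (rule integrable_const_bound[where B = "\<bar>a\<bar> + \<bar>b\<bar>"])
        (use gm gb in auto)
    have ub: "\<bar>u x\<bar> \<le> \<bar>a\<bar> + \<bar>b\<bar>" for x using uab[of x] by linarith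
    have iu: "integrable L u"
      by (rule integrable_const_bound[where B = "\<bar>a\<bar> + \<bar>b\<bar>"])
        (use um ub in auto)
    have "(\<integral>x. \<bar>g x - u x\<bar> \<partial>L)
        \<le> (\<integral>x. 1 / n + (\<Sum>j\<in>J. \<bar>j / n\<bar> * \<bar>indicator (A j) x - \<theta> j x\<bar>) \<partial>L)"
    proof (rule integral_mono)
      fix x
      have "\<bar>g x - u x\<bar> \<le> \<bar>g x - s x\<bar> + \<bar>s x - t x\<bar>" using gu[of x] by linarith
      also have "s x - t x = (\<Sum>j\<in>J. (j / n) * (indicator (A j) x - \<theta> j x))"
        unfolding s_def t_def by (simp add: sum_subtractf right_diff_distrib)
      also have "\<bar>\<dots>\<bar> \<le> (\<Sum>j\<in>J. \<bar>(j / n) * (indicator (A j) x - \<theta> j x)\<bar>)" by (rule sum_abs)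
      finally show "\<bar>g x - u x\<bar> \<le> 1 / n + (\<Sum>j\<in>J. \<bar>j / n\<bar> * \<bar>indicator (A j) x - \<theta> j x\<bar>)"
        using gs[of x] by (simp add: abs_mult)
    qed (use i1 ig iu in auto)
    also have "\<dots> = measure L UNIV / n + (\<Sum>j\<in>J. \<bar>j / n\<bar> * (\<integral>x. \<bar>indicator (A j) x - \<theta> j x\<bar> \<partial>L))"
      using i1 spL by (subst Bochner_Integration.integral_add) (auto simp: Bochner_Integration.integral_sum)
    also have "\<dots> \<le> T / n + (\<Sum>j\<in>J. \<bar>j / n\<bar> * (e / (2 * C)))"
      using s[THEN less_imp_le] L(3) by (intro add_mono sum_mono mult_left_mono divide_right_mono) auto
    also have "(\<Sum>j\<in>J. \<bar>j / n\<bar> * (e / (2 * C))) = (C - 1) * (e / (2 * C))"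
    proof -
      have "(\<Sum>j\<in>J. \<bar>j / n\<bar>) = C - 1" by (simp add: C_def)
      then show ?thesis by (simp only: sum_distrib_right[symmetric])
    qed
    also have "\<dots> \<le> e / 2" using C e by (simp add: field_simps)
    also have "T / n < e / 2" using n e T by (simp add: field_simps)
    finally show ?thesis by simp
  qed
  show ?thesis
  proof (rule that[OF u])
    show "a \<le> u x \<and> u x \<le> b" for x by (rule uab)
    show "(\<integral>x. \<bar>g x - u x\<bar> \<partial>M) < e" by (rule small[OF M _ \<theta>(3)]) (simp add: T_def)
    show "(\<integral>x. \<bar>g x - u x\<bar> \<partial>N) < e" by (rule small[OF N _ \<theta>(4)]) (simp add: T_def)
  qed
qed

lemma circle_L1_approx_continuous:
  fixes g :: "complex \<Rightarrow> real"
  assumes M: "finite_circle_measure M" and N: "finite_circle_measure N"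
    and g: "g \<in> borel_measurable circle_lebesgue" "\<And>z. z \<in> sphere 0 1 \<Longrightarrow> a \<le> g z \<and> g z \<le> b"
    and e: "e > 0"
  obtains \<theta> :: "complex \<Rightarrow> real" where "continuous_on (sphere 0 1) \<theta>" "\<And>z. a \<le> \<theta> z \<and> \<theta> z \<le> b"
    "(\<integral>z. \<bar>g z - \<theta> z\<bar> \<partial>M) < e" "(\<integral>z. \<bar>g z - \<theta> z\<bar> \<partial>N) < e"
proof -
  define G where "G z = (if z \<in> sphere 0 1 then g z else a)" for z
  have gm: "g \<in> borel_measurable (restrict_space borel (sphere 0 1))"
    using g(1) measurable_cong_sets[OF sets_circle_lebesgue refl] by blast
  have Gm: "G \<in> borel_measurable borel"
    unfolding G_def using gm by (subst (asm) measurable_restrict_space_iff[where c = a]) auto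
  have "a \<le> b" using g(2)[of 1] by simp
  then have Gab: "a \<le> G z \<and> G z \<le> b" for z using g(2)[of z] unfolding G_def by simp
  have idm: "(\<lambda>z. z) \<in> measurable L borel" if "finite_circle_measure L" for L
    unfolding measurable_cong_sets[OF finite_circle_measureD(2)[OF that] refl]
    by (intro measurable_restrict_space1) simp
  have fin: "finite_measure (distr L borel (\<lambda>z. z))" if "finite_circle_measure L" for L
    using finite_measure.finite_measure_distr[OF finite_circle_measureD(1)[OF that] idm[OF that]] .
  obtain \<theta> :: "complex \<Rightarrow> real" where \<theta>: "continuous_on UNIV \<theta>" "\<And>z. a \<le> \<theta> z \<and> \<theta> z \<le> b"
    "(\<integral>z. \<bar>G z - \<theta> z\<bar> \<partial>distr M borel (\<lambda>z. z)) < e"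
    "(\<integral>z. \<bar>G z - \<theta> z\<bar> \<partial>distr N borel (\<lambda>z. z)) < e"
    by (rule bounded_L1_approx_continuous[OF fin[OF M] sets_distr fin[OF N] sets_distr Gm Gab e])
      (rule that)
  have t: "(\<integral>z. \<bar>G z - \<theta> z\<bar> \<partial>distr L borel (\<lambda>z. z)) = (\<integral>z. \<bar>g z - \<theta> z\<bar> \<partial>L)"
    if L: "finite_circle_measure L" for L
  proof -
    have "(\<integral>z. \<bar>G z - \<theta> z\<bar> \<partial>distr L borel (\<lambda>z. z)) = (\<integral>z. \<bar>G z - \<theta> z\<bar> \<partial>L)"
      using Gm borel_measurable_continuous_onI[OF \<theta>(1)] by (intro integral_distr idm L) simp
    also have "\<dots> = (\<integral>z. \<bar>g z - \<theta> z\<bar> \<partial>L)"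
      by (intro Bochner_Integration.integral_cong) (auto simp: G_def finite_circle_measureD[OF L])
    finally show ?thesis .
  qed
  show ?thesis
    by (rule that[OF continuous_on_subset[OF \<theta>(1)] \<theta>(2)])
      (use \<theta>(3,4) in \<open>simp_all only: t[OF M] t[OF N] subset_UNIV\<close>)
qed

section \<open>Jensen's inequality for outer polynomials\<close>

text \<open>A zero-free function in the disc has a holomorphic logarithm, so the mean value property
  computes the mean of \<open>ln \<bar>p\<bar>\<close> on circles of radius below \<open>1\<close>. On the unit circle itself \<open>p\<close>
  may vanish; bounding \<open>ln \<bar>p\<bar>\<^sup>2\<close> by \<open>\<theta> \<bar>p\<bar>\<^sup>2 - 1 - ln \<theta>\<close>, where equality holds for
  \<open>\<theta> = 1 / \<bar>p\<bar>\<^sup>2\<close>, before letting the radius tend to \<open>1\<close> leaves a continuous integrand, so that no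
  logarithmic singularity has to be integrated.\<close>

lemma outer_poly_jensen:
  fixes \<theta> :: "complex \<Rightarrow> real"
  assumes outer: "outer_poly p" and \<theta>: "continuous_on (sphere 0 1) \<theta>" "\<And>z. z \<in> sphere 0 1 \<Longrightarrow> \<theta> z > 0"
  shows "2 * ln (cmod (poly p 0))
    \<le> (\<integral>z. \<theta> z * (cmod (poly p z))\<^sup>2 \<partial>circle_lebesgue) + (\<integral>z. - 1 - ln (\<theta> z) \<partial>circle_lebesgue)"
proof -
  have nz: "\<And>z. z \<in> ball 0 1 \<Longrightarrow> poly p z \<noteq> 0" using outer by (simp add: outer_poly_def)
  have hp: "(\<lambda>z. poly p z) holomorphic_on ball 0 1" by (intro holomorphic_intros)
  obtain g where g: "g holomorphic_on ball 0 1" "\<And>z. z \<in> ball 0 1 \<Longrightarrow> poly p z = exp (g z)"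
    using contractible_imp_holomorphic_log[OF hp convex_imp_contractible[OF convex_ball] nz] by blast
  have lng: "ln (cmod (poly p z)) = Re (g z)" if "z \<in> ball 0 1" for z
    using g(2)[OF that] by simp
  have cl: "continuous_on (sphere 0 1) (\<lambda>z. ln (\<theta> z))"
    using \<theta>(2) by (intro continuous_on_ln \<theta>) force
  have cp: "continuous_on (sphere 0 1) (\<lambda>z. \<theta> z * (cmod (poly p (r * z)))\<^sup>2)" for r :: complex
    by (intro continuous_intros \<theta>)
  have radial: "2 * ln (cmod (poly p 0)) \<le>
      (\<integral>z. \<theta> z * (cmod (poly p (of_real r * z)))\<^sup>2 \<partial>circle_lebesgue) + (\<integral>z. - 1 - ln (\<theta> z) \<partial>circle_lebesgue)"
    if r: "0 < r" "r < 1" for r :: real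
  proof -
    have inb: "of_real r * z \<in> ball 0 1" if "z \<in> cball 0 1" for z :: complex
    proof -
      have "r * cmod z \<le> r * 1" using that r by (intro mult_left_mono) auto
      then have "r * cmod z < 1" using r by linarith
      then show ?thesis using r by (simp add: norm_mult)
    qed
    have hol: "(\<lambda>z. g (of_real r * z)) holomorphic_on cball 0 1"
      by (rule holomorphic_on_compose_gen[OF _ g(1), unfolded o_def])
        (use inb in \<open>auto intro!: holomorphic_intros\<close>)
    have cg: "continuous_on (sphere 0 1) (\<lambda>z. g (of_real r * z))"
      using holomorphic_on_imp_continuous_on[OF hol] by (rule continuous_on_subset) auto
    have "2 * ln (cmod (poly p 0)) = 2 * Re (\<integral>z. g (of_real r * z) \<partial>circle_lebesgue)"
      using integral_circle_holomorphic[OF hol] lng[of 0] by simp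
    also have "\<dots> = 2 * (\<integral>z. Re (g (of_real r * z)) \<partial>circle_lebesgue)"
      using circle_integrable[OF cg] by simp
    also have "\<dots> = (\<integral>z. 2 * Re (g (of_real r * z)) \<partial>circle_lebesgue)" by simp
    also have "\<dots> \<le> (\<integral>z. \<theta> z * (cmod (poly p (of_real r * z)))\<^sup>2 + (- 1 - ln (\<theta> z)) \<partial>circle_lebesgue)"
    proof (rule integral_mono)
      show "integrable circle_lebesgue (\<lambda>z. 2 * Re (g (of_real r * z)))"
        using circle_integrable[OF cg] by auto
      show "integrable circle_lebesgue (\<lambda>z. \<theta> z * (cmod (poly p (of_real r * z)))\<^sup>2 + (- 1 - ln (\<theta> z)))"
        by (intro circle_integrable continuous_intros cp cl)
      fix z assume "z \<in> space circle_lebesgue"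
      then have z: "z \<in> sphere 0 1" by (simp add: space_circle_lebesgue)
      then have rz: "of_real r * z \<in> ball 0 1" by (intro inb) auto
      have pos: "cmod (poly p (of_real r * z)) > 0" using nz[OF rz] by simp
      have "ln (\<theta> z * (cmod (poly p (of_real r * z)))\<^sup>2) \<le> \<theta> z * (cmod (poly p (of_real r * z)))\<^sup>2 - 1"
        using pos \<theta>(2)[OF z] by (intro ln_le_minus_one) auto
      moreover have "ln (\<theta> z * (cmod (poly p (of_real r * z)))\<^sup>2) = ln (\<theta> z) + 2 * Re (g (of_real r * z))"
        using pos \<theta>(2)[OF z] lng[OF rz] by (simp add: ln_mult ln_realpow)
      ultimately show "2 * Re (g (of_real r * z)) \<le> \<theta> z * (cmod (poly p (of_real r * z)))\<^sup>2 + (- 1 - ln (\<theta> z))"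
        by linarith
    qed
    also have "\<dots> = (\<integral>z. \<theta> z * (cmod (poly p (of_real r * z)))\<^sup>2 \<partial>circle_lebesgue) + (\<integral>z. - 1 - ln (\<theta> z) \<partial>circle_lebesgue)"
      by (rule Bochner_Integration.integral_add) (intro circle_integrable continuous_intros cp cl)+
    finally show ?thesis .
  qed
  define r where "r n = 1 - inverse (real (Suc (Suc n)))" for n
  have r: "0 < r n" "r n < 1" for n by (auto simp: r_def field_simps)
  have rl: "r \<longlonglongrightarrow> 1"
    using LIMSEQ_Suc[OF LIMSEQ_inverse_real_of_nat_add_minus[of 1]] by (simp add: r_def[abs_def])
  have "continuous_on (cball 0 1) (\<lambda>z. (cmod (poly p z))\<^sup>2)" by (intro continuous_intros)
  then have "compact ((\<lambda>z. (cmod (poly p z))\<^sup>2) ` cball 0 1)" by (rule compact_continuous_image) auto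
  then obtain C where C: "\<And>z. z \<in> cball 0 1 \<Longrightarrow> (cmod (poly p z))\<^sup>2 \<le> C"
    using compact_imp_bounded bounded_iff
    by (metis (no_types, lifting) abs_le_D1 image_eqI real_norm_def)
  have lim: "(\<lambda>n. \<integral>z. \<theta> z * (cmod (poly p (of_real (r n) * z)))\<^sup>2 \<partial>circle_lebesgue)
      \<longlonglongrightarrow> (\<integral>z. \<theta> z * (cmod (poly p z))\<^sup>2 \<partial>circle_lebesgue)"
  proof (rule integral_dominated_convergence[where w = "\<lambda>z. \<theta> z * C"])
    show "(\<lambda>z. \<theta> z * (cmod (poly p z))\<^sup>2) \<in> borel_measurable circle_lebesgue"
      using circle_integrable[OF cp[of 1]] by auto
    show "\<And>n. (\<lambda>z. \<theta> z * (cmod (poly p (of_real (r n) * z)))\<^sup>2) \<in> borel_measurable circle_lebesgue"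
      using circle_integrable[OF cp] by auto
    show "integrable circle_lebesgue (\<lambda>z. \<theta> z * C)" by (intro circle_integrable continuous_intros \<theta>)
    show "AE z in circle_lebesgue. (\<lambda>n. \<theta> z * (cmod (poly p (of_real (r n) * z)))\<^sup>2)
        \<longlonglongrightarrow> \<theta> z * (cmod (poly p z))\<^sup>2"
    proof (rule AE_I2)
      fix z :: complex
      have "(\<lambda>n. of_real (r n) * z) \<longlonglongrightarrow> of_real 1 * z"
        by (intro tendsto_intros rl)
      then have "(\<lambda>n. of_real (r n) * z) \<longlonglongrightarrow> z" by simp
      from isCont_tendsto_compose[OF _ this, of "poly p"]
      show "(\<lambda>n. \<theta> z * (cmod (poly p (of_real (r n) * z)))\<^sup>2) \<longlonglongrightarrow> \<theta> z * (cmod (poly p z))\<^sup>2"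
        by (intro tendsto_mult tendsto_const tendsto_power tendsto_norm) auto
    qed
    show "AE z in circle_lebesgue. norm (\<theta> z * (cmod (poly p (of_real (r n) * z)))\<^sup>2) \<le> \<theta> z * C" for n
    proof (rule AE_I2)
      fix z assume "z \<in> space circle_lebesgue"
      then have z: "z \<in> sphere 0 1" by (simp add: space_circle_lebesgue)
      then have "of_real (r n) * z \<in> cball 0 1" using r[of n] by (auto simp: norm_mult)
      from C[OF this] show "norm (\<theta> z * (cmod (poly p (of_real (r n) * z)))\<^sup>2) \<le> \<theta> z * C"
        using \<theta>(2)[OF z] by (simp add: abs_mult)
    qed
  qed
  show ?thesis
    by (rule LIMSEQ_le_const[OF tendsto_add[OF lim tendsto_const]]) (use radial[OF r] in auto)
qed


section \<open>The absolutely continuous part\<close>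

lemma ac_density_restriction:
  assumes h: "is_ac_density M N h" and fin: "finite_measure N"
  obtains A where "A \<in> sets M" "emeasure M A = 0"
    "density N (indicator (space M - A)) = density M (\<lambda>x. ennreal (enn2real (h x)))"
proof -
  have hm[measurable]: "h \<in> borel_measurable M" and s: "sets N = sets M" using h by (auto simp: is_ac_density_def)
  obtain Ns where sing: "mutually_singular M Ns"
    and dec: "\<And>A. A \<in> sets M \<Longrightarrow> emeasure N A = emeasure (density M h) A + emeasure Ns A"
    using h by (auto simp: is_ac_density_def)
  obtain A where sNs: "sets M = sets Ns" and A[measurable]: "A \<in> sets M" and A0: "emeasure M A = 0"
    and As: "emeasure Ns (space Ns - A) = 0"
    using sing by (auto simp: mutually_singular_def)
  have sp: "space Ns = space M" "space N = space M" using sNs s by (auto dest: sets_eq_imp_space_eq)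
  interpret N: finite_measure N by fact
  have "(\<integral>\<^sup>+x. h x \<partial>M) = emeasure (density M h) (space M)" by (auto simp: emeasure_density cong: nn_integral_cong)
  also have "\<dots> \<le> emeasure N (space M)" by (subst dec) auto
  also have "\<dots> < \<infinity>" using N.emeasure_finite by (simp add: less_top[symmetric])
  finally have "AE x in M. h x \<noteq> \<infinity>" by (intro nn_integral_PInf_AE) auto
  then have dh: "density M (\<lambda>x. ennreal (enn2real (h x))) = density M h"
    by (intro density_cong) (auto simp: less_top)
  have "density N (indicator (space M - A)) = density M h"
  proof (rule measure_eqI)
    show "sets (density N (indicator (space M - A))) = sets (density M h)" by (simp add: s)
    fix B assume "B \<in> sets (density N (indicator (space M - A)))"
    then have B[measurable]: "B \<in> sets M" by (simp add: s)
    have AN: "A \<in> sets N" "B \<in> sets N" "space M - A \<in> sets N" using s A B by auto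
    have "emeasure (density N (indicator (space M - A))) B
        = (\<integral>\<^sup>+x. indicator (space M - A) x * indicator B x \<partial>N)"
      using AN by (intro emeasure_density) auto
    also have "\<dots> = (\<integral>\<^sup>+x. indicator (B - A) x \<partial>N)"
      using sets.sets_into_space[OF B] by (intro nn_integral_cong) (auto simp: indicator_def)
    also have "\<dots> = emeasure N (B - A)" using AN by simp
    also have "\<dots> = emeasure (density M h) (B - A) + emeasure Ns (B - A)" by (intro dec) auto
    also have "emeasure Ns (B - A) = 0"
    proof (rule emeasure_eq_0)
      show "space Ns - A \<in> sets Ns" using A unfolding sNs by (rule sets.compl_sets)
      show "B - A \<subseteq> space Ns - A" using sets.sets_into_space[OF B] unfolding sp by blast
    qed (rule As)
    also have "emeasure (density M h) (B - A) + 0 = emeasure (density M h) B"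
    proof -
      have "A \<in> null_sets (density M h)"
        using A A0 absolutely_continuousI_density[OF hm]
        unfolding absolutely_continuous_def null_sets_def by blast
      then show ?thesis using B by (simp add: emeasure_Diff_null_set)
    qed
    finally show "emeasure (density N (indicator (space M - A))) B = emeasure (density M h) B" .
  qed
  from that[OF A A0 trans[OF this dh[symmetric]]] show ?thesis .
qed

lemma ac_density_integral_le:
  fixes f :: "'a \<Rightarrow> real"
  assumes h: "is_ac_density M N h" and fin: "finite_measure N"
    and f: "integrable N f" "\<And>x. x \<in> space M \<Longrightarrow> f x \<ge> 0"
  shows "integrable M (\<lambda>x. f x * enn2real (h x))"
    "(\<integral>x. f x * enn2real (h x) \<partial>M) \<le> (\<integral>x. f x \<partial>N)"
proof -
  obtain A where A: "A \<in> sets M" "emeasure M A = 0"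
    and d: "density N (indicator (space M - A)) = density M (\<lambda>x. ennreal (enn2real (h x)))"
    by (rule ac_density_restriction[OF h fin])
  have hm[measurable]: "h \<in> borel_measurable M" and s: "sets N = sets M" using h by (auto simp: is_ac_density_def)
  have sp: "space N = space M" using s by (rule sets_eq_imp_space_eq)
  have fN[measurable]: "f \<in> borel_measurable N" using f(1) by auto
  then have fM[measurable]: "f \<in> borel_measurable M" using measurable_cong_sets[OF s refl] by blast
  have AN: "space M - A \<in> sets N" using A s by auto
  have i: "density N (indicator (space M - A)) = density N (\<lambda>x. ennreal (indicator (space M - A) x))"
    by (rule arg_cong[where f = "density N"]) (auto simp: fun_eq_iff indicator_def)
  have int: "integrable N (\<lambda>x. indicator (space M - A) x *\<^sub>R f x)"
    by (rule integrable_mult_indicator[OF AN f(1)])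
  have "integrable (density N (indicator (space M - A))) f"
    unfolding i using int by (subst integrable_density) (use AN in auto)
  then have "integrable M (\<lambda>x. enn2real (h x) *\<^sub>R f x)"
    unfolding d by (subst (asm) integrable_density) auto
  then show "integrable M (\<lambda>x. f x * enn2real (h x))" by (simp add: mult.commute)
  have "(\<integral>x. f x * enn2real (h x) \<partial>M) = (\<integral>x. enn2real (h x) *\<^sub>R f x \<partial>M)" by (simp add: mult.commute)
  also have "\<dots> = (\<integral>x. f x \<partial>density M (\<lambda>x. ennreal (enn2real (h x))))"
    by (rule integral_density[symmetric]) auto
  also have "\<dots> = (\<integral>x. f x \<partial>density N (indicator (space M - A)))" by (simp only: d)
  also have "\<dots> = (\<integral>x. indicator (space M - A) x *\<^sub>R f x \<partial>N)"
    unfolding i by (rule integral_density) (use AN in auto)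
  also have "\<dots> \<le> (\<integral>x. f x \<partial>N)"
    by (rule integral_mono[OF int f(1)]) (use f(2) sp in \<open>auto simp: indicator_def\<close>)
  finally show "(\<integral>x. f x * enn2real (h x) \<partial>M) \<le> (\<integral>x. f x \<partial>N)" .
qed

lemma mutually_singular_if_ac_density_0:
  assumes h: "is_ac_density M N h" and fin: "finite_measure N"
    and z: "AE x in M. enn2real (h x) = 0"
  shows "mutually_singular N M"
proof -
  obtain A where A: "A \<in> sets M" "emeasure M A = 0"
    and d: "density N (indicator (space M - A)) = density M (\<lambda>x. ennreal (enn2real (h x)))"
    by (rule ac_density_restriction[OF h fin])
  have hm[measurable]: "h \<in> borel_measurable M" and s: "sets N = sets M" using h by (auto simp: is_ac_density_def)
  have AN: "space M - A \<in> sets N" using A s by auto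
  have "emeasure N (space M - A) = (\<integral>\<^sup>+x. indicator (space M - A) x * indicator (space M - A) x \<partial>N)"
    using AN by (simp add: indicator_inter_arith[symmetric])
  also have "\<dots> = emeasure (density N (indicator (space M - A))) (space M - A)"
    using AN by (intro emeasure_density[symmetric]) auto
  also have "\<dots> = (\<integral>\<^sup>+x. ennreal (enn2real (h x)) * indicator (space M - A) x \<partial>M)"
    unfolding d using A by (intro emeasure_density) auto
  also have "\<dots> = (\<integral>\<^sup>+x. 0 \<partial>M)"
    using z by (intro nn_integral_cong_AE) (auto elim!: eventually_mono)
  also have "\<dots> = 0" by simp
  finally show ?thesis
    using A AN s sets.sets_into_space[OF A(1)]
    by (auto simp: mutually_singular_def double_diff intro!: bexI[of _ "space M - A"])
qed

text \<open>Weak limits only control integrals of continuous functions, while the optimal test function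
  for the inequalities below is built from the density \<open>h\<close> and has to ignore the singular part of
  \<open>N\<close>. Continuous functions approximate a measurable one in \<open>L\<^sup>1\<close> of both \<open>N\<close> and
  Lebesgue measure; replacing that function by its lower bound \<open>a\<close> on a Lebesgue null set that
  carries the singular part reduces the contribution of the singular part to at most \<open>a\<close> times the
  mass of \<open>N\<close>.\<close>

lemma continuous_test_inequality_extends:
  fixes \<theta> :: "complex \<Rightarrow> real" and H :: "real \<Rightarrow> real" and a b c L :: real
  assumes h: "is_ac_density circle_lebesgue N h" and N: "finite_circle_measure N"
    and H: "\<And>x y. x \<in> {a..b} \<Longrightarrow> y \<in> {a..b} \<Longrightarrow> \<bar>H x - H y\<bar> \<le> L * \<bar>x - y\<bar>" "continuous_on {a..b} H"
    and ab: "0 < a"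
    and test: "\<And>\<theta>. continuous_on (sphere 0 1) \<theta> \<Longrightarrow> (\<And>z. a \<le> \<theta> z \<and> \<theta> z \<le> b) \<Longrightarrow>
        c \<le> (\<integral>z. \<theta> z \<partial>N) + (\<integral>z. H (\<theta> z) \<partial>circle_lebesgue)"
    and \<theta>: "\<theta> \<in> borel_measurable circle_lebesgue" "\<And>z. a \<le> \<theta> z \<and> \<theta> z \<le> b"
  shows "c \<le> a * measure N (space N) + (\<integral>z. \<theta> z * enn2real (h z) \<partial>circle_lebesgue)
      + (\<integral>z. H (\<theta> z) \<partial>circle_lebesgue)"
proof -
  interpret N: finite_measure N using finite_circle_measureD[OF N] by simp
  obtain A where A: "A \<in> sets circle_lebesgue" "emeasure circle_lebesgue A = 0"
    and d: "density N (indicator (space circle_lebesgue - A))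
        = density circle_lebesgue (\<lambda>x. ennreal (enn2real (h x)))"
    by (rule ac_density_restriction[OF h N.finite_measure_axioms])
  have hm[measurable]: "h \<in> borel_measurable circle_lebesgue" and s: "sets N = sets circle_lebesgue"
    using h by (auto simp: is_ac_density_def)
  have sp: "space N = space circle_lebesgue" using s by (rule sets_eq_imp_space_eq)
  have toN: "f \<in> borel_measurable N" if "f \<in> borel_measurable circle_lebesgue" for f :: "complex \<Rightarrow> real"
    using that measurable_cong_sets[OF s refl] by blast
  have AN: "A \<in> sets N" "space circle_lebesgue - A \<in> sets N" using A s by auto
  define \<theta>0 where "\<theta>0 z = (if z \<in> A then a else \<theta> z)" for z
  have r0: "a \<le> \<theta>0 z" "\<theta>0 z \<le> b" for z
    using \<theta>(2)[of z] by (auto simp: \<theta>0_def)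
  have m0[measurable]: "\<theta>0 \<in> borel_measurable circle_lebesgue"
    unfolding \<theta>0_def using A \<theta>(1) by measurable
  define H' where "H' x = H (max a (min b x))" for x
  have H'm[measurable]: "H' \<in> borel_measurable borel"
    unfolding H'_def
    by (intro borel_measurable_continuous_onI continuous_on_compose2[OF H(2)])
      (use \<theta>(2)[of undefined] in \<open>auto intro!: continuous_intros\<close>)
  have "compact (H ` {a..b})" by (intro compact_continuous_image H) simp
  then obtain K where K: "\<And>x. x \<in> {a..b} \<Longrightarrow> \<bar>H x\<bar> \<le> K"
    using compact_imp_bounded bounded_iff by (metis image_eqI real_norm_def)
  have iH: "integrable circle_lebesgue (\<lambda>z. H (f z))"
    if fm[measurable]: "f \<in> borel_measurable circle_lebesgue" and fr: "\<And>z. a \<le> f z \<and> f z \<le> b" for f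
  proof -
    have "(\<lambda>z. H (f z)) = (\<lambda>z. H' (f z))" using fr by (simp add: H'_def min_absorb2 max_absorb2)
    moreover have "(\<lambda>z. H' (f z)) \<in> borel_measurable circle_lebesgue" by measurable
    ultimately show ?thesis
      by (intro circle_lebesgue.integrable_const_bound[where B = K]) (use K fr in auto)
  qed
  have abs_le: "\<bar>f z\<bar> \<le> b" if "\<And>z. a \<le> f z \<and> f z \<le> b" for f :: "complex \<Rightarrow> real" and z
    using that[of z] ab by linarith
  have iN: "integrable N f" if "f \<in> borel_measurable circle_lebesgue" "\<And>z. a \<le> f z \<and> f z \<le> b" for f
    by (rule N.integrable_const_bound[where B = b]) (use toN[OF that(1)] abs_le[of f, OF that(2)] in auto)
  have iC: "integrable circle_lebesgue f" if "f \<in> borel_measurable circle_lebesgue" "\<And>z. a \<le> f z \<and> f z \<le> b" for f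
    by (rule circle_lebesgue.integrable_const_bound[where B = b]) (use that(1) abs_le[of f, OF that(2)] in auto)
  have "c \<le> (\<integral>z. \<theta>0 z \<partial>N) + (\<integral>z. H (\<theta>0 z) \<partial>circle_lebesgue)"
  proof (rule field_le_epsilon)
    fix e :: real assume e: "e > 0"
    define e' where "e' = e / (1 + \<bar>L\<bar>)"
    have e': "e' > 0" "e' * (1 + \<bar>L\<bar>) = e" using e by (auto simp: e'_def field_simps add_pos_nonneg)
    obtain t :: "complex \<Rightarrow> real" where t: "continuous_on (sphere 0 1) t" "\<And>z. a \<le> t z \<and> t z \<le> b"
      "(\<integral>z. \<bar>\<theta>0 z - t z\<bar> \<partial>N) < e'" "(\<integral>z. \<bar>\<theta>0 z - t z\<bar> \<partial>circle_lebesgue) < e'"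
      by (rule circle_L1_approx_continuous[OF N finite_circle_measure_circle_lebesgue m0 _ e'(1)])
        (use r0 in blast, rule that)
    have tm: "t \<in> borel_measurable circle_lebesgue"
      by (rule borel_measurable_circle_continuous[OF sets_circle_lebesgue t(1)])
    have "(\<integral>z. t z \<partial>N) - (\<integral>z. \<theta>0 z \<partial>N) = (\<integral>z. t z - \<theta>0 z \<partial>N)"
      using iN[OF tm t(2)] iN[OF m0] r0 by simp
    also have "\<dots> \<le> (\<integral>z. \<bar>\<theta>0 z - t z\<bar> \<partial>N)"
      using iN[OF tm t(2)] iN[OF m0] r0 by (intro integral_mono) auto
    finally have 1: "(\<integral>z. t z \<partial>N) \<le> (\<integral>z. \<theta>0 z \<partial>N) + e'" using t(3) by simp
    have "(\<integral>z. H (t z) \<partial>circle_lebesgue) - (\<integral>z. H (\<theta>0 z) \<partial>circle_lebesgue)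
        = (\<integral>z. H (t z) - H (\<theta>0 z) \<partial>circle_lebesgue)"
      using iH[OF tm t(2)] iH[OF m0] r0 by simp
    also have "\<dots> \<le> (\<integral>z. \<bar>L\<bar> * \<bar>\<theta>0 z - t z\<bar> \<partial>circle_lebesgue)"
    proof (rule integral_mono)
      fix z
      have "\<bar>H (t z) - H (\<theta>0 z)\<bar> \<le> L * \<bar>t z - \<theta>0 z\<bar>" using t(2)[of z] r0[of z] by (intro H(1)) auto
      also have "\<dots> \<le> \<bar>L\<bar> * \<bar>t z - \<theta>0 z\<bar>" by (intro mult_right_mono) auto
      finally show "H (t z) - H (\<theta>0 z) \<le> \<bar>L\<bar> * \<bar>\<theta>0 z - t z\<bar>" by (simp add: abs_minus_commute)
    qed (use iH[OF tm t(2)] iH[OF m0] iC[OF tm t(2)] iC[OF m0] r0 in auto)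
    also have "\<dots> = \<bar>L\<bar> * (\<integral>z. \<bar>\<theta>0 z - t z\<bar> \<partial>circle_lebesgue)" by simp
    also have "\<dots> \<le> \<bar>L\<bar> * e'" using t(4) by (intro mult_left_mono) auto
    finally have 2: "(\<integral>z. H (t z) \<partial>circle_lebesgue) \<le> (\<integral>z. H (\<theta>0 z) \<partial>circle_lebesgue) + \<bar>L\<bar> * e'" by simp
    have "e' + \<bar>L\<bar> * e' = e" using e'(2) by (simp add: algebra_simps)
    then show "c \<le> (\<integral>z. \<theta>0 z \<partial>N) + (\<integral>z. H (\<theta>0 z) \<partial>circle_lebesgue) + e"
      using 1 2 test[OF t(1,2)] by linarith
  qed
  also have "(\<integral>z. H (\<theta>0 z) \<partial>circle_lebesgue) = (\<integral>z. H (\<theta> z) \<partial>circle_lebesgue)"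
  proof (rule integral_cong_AE)
    show "(\<lambda>z. H (\<theta>0 z)) \<in> borel_measurable circle_lebesgue" using iH[OF m0] r0 by auto
    show "(\<lambda>z. H (\<theta> z)) \<in> borel_measurable circle_lebesgue" using iH[OF \<theta>] by auto
    show "AE z in circle_lebesgue. H (\<theta>0 z) = H (\<theta> z)"
      using AE_not_in[of A circle_lebesgue] A by (auto simp: null_sets_def \<theta>0_def elim!: eventually_mono)
  qed
  also have "(\<integral>z. \<theta>0 z \<partial>N) \<le> a * measure N (space N) + (\<integral>z. \<theta> z * enn2real (h z) \<partial>circle_lebesgue)"
  proof -
    have i: "density N (indicator (space circle_lebesgue - A)) = density N (\<lambda>x. ennreal (indicator (space circle_lebesgue - A) x))"
      by (rule arg_cong[where f = "density N"]) (auto simp: fun_eq_iff indicator_def)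
    have int: "integrable N (\<lambda>z. indicator (space circle_lebesgue - A) z *\<^sub>R \<theta> z)"
      by (rule integrable_mult_indicator[OF AN(2) iN[OF \<theta>]])
    have "(\<integral>z. \<theta>0 z \<partial>N) \<le> (\<integral>z. a + indicator (space circle_lebesgue - A) z *\<^sub>R \<theta> z \<partial>N)"
    proof (rule integral_mono)
      show "integrable N \<theta>0" using iN[OF m0] r0 by simp
      show "integrable N (\<lambda>z. a + indicator (space circle_lebesgue - A) z *\<^sub>R \<theta> z)"
        using int by simp
      fix z assume "z \<in> space N"
      then show "\<theta>0 z \<le> a + indicator (space circle_lebesgue - A) z *\<^sub>R \<theta> z"
        using ab \<theta>(2)[of z] by (auto simp: \<theta>0_def sp indicator_def)
    qed
    also have "\<dots> = a * measure N (space N) + (\<integral>z. indicator (space circle_lebesgue - A) z *\<^sub>R \<theta> z \<partial>N)"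
      using int by (subst Bochner_Integration.integral_add) auto
    also have "(\<integral>z. indicator (space circle_lebesgue - A) z *\<^sub>R \<theta> z \<partial>N)
        = (\<integral>z. \<theta> z \<partial>density N (indicator (space circle_lebesgue - A)))"
      unfolding i by (rule integral_density[symmetric]) (use AN toN[OF \<theta>(1)] in auto)
    also have "\<dots> = (\<integral>z. enn2real (h z) *\<^sub>R \<theta> z \<partial>circle_lebesgue)"
      unfolding d by (rule integral_density) (use \<theta>(1) in auto)
    finally show ?thesis by (simp add: mult.commute)
  qed
  finally show ?thesis by simp
qed


section \<open>Products of trigonometric polynomials and their tails\<close>

lemma trig_polynomial_continuous:
  assumes "trig_polynomial f" shows "continuous_on (sphere 0 1) f"
proof -
  obtain m c where f: "\<And>z. z \<in> sphere 0 1 \<Longrightarrow> f z = (\<Sum>k = - int m..int m. c k * z powi k)"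
    using assms by (auto simp: trig_polynomial_def)
  have "continuous_on (sphere 0 1) (\<lambda>z. \<Sum>k = - int m..int m. c k * z powi k)"
    by (intro continuous_intros) auto
  then show ?thesis using f by (subst continuous_on_cong[OF refl f]) auto
qed

lemma product_measure_integral_tendsto:
  fixes g :: "complex \<Rightarrow> real"
  assumes Q: "\<And>j. continuous_on (sphere 0 1) (Q j)" and "is_product_measure Q \<nu>"
    and g: "continuous_on (sphere 0 1) g"
  shows "(\<lambda>n. \<integral>z. (cmod (\<Prod>j<n. Q j z))\<^sup>2 * g z \<partial>circle_lebesgue) \<longlonglongrightarrow> (\<integral>z. g z \<partial>\<nu>)"
proof -
  have "(\<integral>z. g z \<partial>partial_product_measure Q n) = (\<integral>z. (cmod (\<Prod>j<n. Q j z))\<^sup>2 *\<^sub>R g z \<partial>circle_lebesgue)" for n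
    unfolding partial_product_measure_def
  proof (rule integral_density)
    show "g \<in> borel_measurable circle_lebesgue"
      using circle_integrable[OF g] by auto
    have "continuous_on (sphere 0 1) (\<lambda>z. (cmod (\<Prod>j<n. Q j z))\<^sup>2)"
      by (intro continuous_intros Q)
    from circle_integrable[OF this]
    show "(\<lambda>z. (cmod (\<Prod>j<n. Q j z))\<^sup>2) \<in> borel_measurable circle_lebesgue" by auto
  qed auto
  then show ?thesis using assms by (auto simp: is_product_measure_def weakly_converges_def)
qed

lemma prod_lessThan_add: "(\<Prod>j<n + m. f j) = (\<Prod>j<n. f j) * (\<Prod>j<m. f (n + j))" for f :: "nat \<Rightarrow> 'a::comm_monoid_mult"
  by (induction m) (auto simp: mult.assoc)

lemma product_measure_split_integral:
  fixes g :: "complex \<Rightarrow> real"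
  assumes Q: "\<And>j. continuous_on (sphere 0 1) (Q j)" and \<mu>: "is_product_measure Q \<mu>"
    and \<nu>: "is_product_measure (\<lambda>j. Q (n + j)) \<nu>" and g: "continuous_on (sphere 0 1) g"
  shows "(\<integral>z. g z \<partial>\<mu>) = (\<integral>z. (cmod (\<Prod>j<n. Q j z))\<^sup>2 * g z \<partial>\<nu>)"
proof (rule LIMSEQ_unique)
  show "(\<lambda>m. \<integral>z. (cmod (\<Prod>j<m + n. Q j z))\<^sup>2 * g z \<partial>circle_lebesgue) \<longlonglongrightarrow> (\<integral>z. g z \<partial>\<mu>)"
    using product_measure_integral_tendsto[OF Q \<mu> g] by (rule LIMSEQ_ignore_initial_segment)
  have "(\<lambda>m. \<integral>z. (cmod (\<Prod>j<m. Q (n + j) z))\<^sup>2 * ((cmod (\<Prod>j<n. Q j z))\<^sup>2 * g z) \<partial>circle_lebesgue)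
      \<longlonglongrightarrow> (\<integral>z. (cmod (\<Prod>j<n. Q j z))\<^sup>2 * g z \<partial>\<nu>)"
    by (rule product_measure_integral_tendsto[OF Q \<nu>]) (intro continuous_intros Q g)
  moreover have "(cmod (\<Prod>j<m. Q (n + j) z))\<^sup>2 * ((cmod (\<Prod>j<n. Q j z))\<^sup>2 * g z)
      = (cmod (\<Prod>j<m + n. Q j z))\<^sup>2 * g z" for m z
    using prod_lessThan_add[of "\<lambda>j. Q j z" n m] by (simp add: norm_mult power_mult_distrib add.commute mult.commute)
  ultimately show "(\<lambda>m. \<integral>z. (cmod (\<Prod>j<m + n. Q j z))\<^sup>2 * g z \<partial>circle_lebesgue)
      \<longlonglongrightarrow> (\<integral>z. (cmod (\<Prod>j<n. Q j z))\<^sup>2 * g z \<partial>\<nu>)" by simp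
qed

lemma product_measure_mass:
  assumes Q: "\<And>j. continuous_on (sphere 0 1) (Q j)" and \<mu>: "is_product_measure Q \<mu>"
    and 1: "\<And>n. (\<integral>z. (cmod (\<Prod>j<n. Q j z))\<^sup>2 \<partial>circle_lebesgue) = 1"
  shows "measure \<mu> (space \<mu>) = 1"
proof -
  have "(\<lambda>n. \<integral>z. (cmod (\<Prod>j<n. Q j z))\<^sup>2 * 1 \<partial>circle_lebesgue) \<longlonglongrightarrow> (\<integral>z. 1 \<partial>\<mu>)"
    by (rule product_measure_integral_tendsto[OF Q \<mu>]) auto
  then have "(\<lambda>n. 1) \<longlonglongrightarrow> measure \<mu> (space \<mu>)" using 1 by simp
  then show ?thesis by (simp add: LIMSEQ_const_iff)
qed

text \<open>The density of a tail is that of the whole product divided by \<open>\<bar>Q\<^sub>0 \<dots> Q\<^sub>n\<^sub>-\<^sub>1\<bar>\<^sup>2\<close>. Only the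
  inequality that this gives for integrals is established. Adding \<open>1 / (k + 1)\<close> to the denominator keeps the
  test functions continuous at the zeros of the partial product.\<close>

lemma tail_density_integral_le:
  fixes v :: "complex \<Rightarrow> real"
  assumes Q: "\<And>j. continuous_on (sphere 0 1) (Q j)" and \<mu>: "is_product_measure Q \<mu>"
    and h: "is_ac_density circle_lebesgue \<mu> h"
    and \<nu>: "is_product_measure (\<lambda>j. Q (n + j)) \<nu>"
    and nz: "AE z in circle_lebesgue. (\<Prod>j<n. Q j z) \<noteq> 0"
    and v: "continuous_on (sphere 0 1) v" "\<And>z. v z \<ge> 0"
  shows "integrable circle_lebesgue (\<lambda>z. v z * (enn2real (h z) / (cmod (\<Prod>j<n. Q j z))\<^sup>2))"
    "(\<integral>z. v z * (enn2real (h z) / (cmod (\<Prod>j<n. Q j z))\<^sup>2) \<partial>circle_lebesgue) \<le> (\<integral>z. v z \<partial>\<nu>)"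
proof -
  define p where "p z = (cmod (\<Prod>j<n. Q j z))\<^sup>2" for z
  define d where "d k = 1 / real (Suc k)" for k
  have d: "d k > 0" for k by (simp add: d_def)
  have dlim: "d \<longlonglongrightarrow> 0" unfolding d_def[abs_def] by (rule lim_1_over_n[THEN LIMSEQ_Suc])
  define g where "g k z = v z / (p z + d k)" for k z
  define F where "F k z = g k z * enn2real (h z)" for k z
  define U where "U z = v z * (enn2real (h z) / p z)" for z
  have p: "continuous_on (sphere 0 1) p" unfolding p_def by (intro continuous_intros Q)
  have p0: "p z \<ge> 0" for z by (simp add: p_def)
  have pd: "p z + d k > 0" for z k using p0[of z] d[of k] by linarith
  have g: "continuous_on (sphere 0 1) (g k)" for k
    unfolding g_def by (intro continuous_intros v p) (metis pd less_irrefl)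
  have g0: "g k z \<ge> 0" for k z using pd[of z k] v(2)[of z] by (simp add: g_def)
  have fc: "finite_circle_measure \<mu>" "finite_circle_measure \<nu>"
    using \<mu> \<nu> by (auto simp: is_product_measure_def)
  have hm[measurable]: "h \<in> borel_measurable circle_lebesgue" using h by (auto simp: is_ac_density_def)
  have [measurable]: "p \<in> borel_measurable circle_lebesgue" "v \<in> borel_measurable circle_lebesgue"
    using circle_integrable[OF p] circle_integrable[OF v(1)] by auto
  have F: "integrable circle_lebesgue (F k)" "(\<integral>z. F k z \<partial>circle_lebesgue) \<le> (\<integral>z. v z \<partial>\<nu>)" for k
  proof -
    note le = ac_density_integral_le[OF h finite_circle_measureD(1)[OF fc(1)] integrable_circle_continuous[OF fc(1) g[of k]] g0]
    show "integrable circle_lebesgue (F k)" using le(1) by (simp add: F_def[abs_def])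
    have "(\<integral>z. F k z \<partial>circle_lebesgue) \<le> (\<integral>z. g k z \<partial>\<mu>)" using le(2) by (simp add: F_def)
    also have "\<dots> = (\<integral>z. p z * g k z \<partial>\<nu>)"
      unfolding p_def by (rule product_measure_split_integral[OF Q \<mu> \<nu> g])
    also have "\<dots> \<le> (\<integral>z. v z \<partial>\<nu>)"
    proof (rule integral_mono)
      show "integrable \<nu> (\<lambda>z. p z * g k z)" "integrable \<nu> v"
        by (intro integrable_circle_continuous[OF fc(2)] continuous_intros p g v)+
      fix z
      have "p z * v z \<le> v z * (p z + d k)"
        using v(2)[of z] d[of k] by (simp add: algebra_simps)
      then show "p z * g k z \<le> v z" using pd[of z k] by (simp add: g_def divide_le_eq)
    qed
    finally show "(\<integral>z. F k z \<partial>circle_lebesgue) \<le> (\<integral>z. v z \<partial>\<nu>)" .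
  qed
  have F0: "F k z \<ge> 0" for k z using g0 by (simp add: F_def)
  have nv: "(\<integral>z. v z \<partial>\<nu>) \<ge> 0" using v by (intro Bochner_Integration.integral_nonneg) auto
  have Fm: "(\<lambda>z. ennreal (F k z)) \<in> borel_measurable circle_lebesgue" for k
    using F(1) by (intro measurable_compose[OF _ measurable_ennreal]) auto
  have inc: "incseq (\<lambda>k z. ennreal (F k z))"
  proof (intro incseq_SucI le_funI ennreal_leI)
    fix k z
    have "d (Suc k) \<le> d k" by (simp add: d_def frac_le)
    then have "g k z \<le> g (Suc k) z"
      using v(2)[of z] pd[of z "Suc k"] by (auto simp: g_def intro!: divide_left_mono mult_pos_pos pd)
    then show "F k z \<le> F (Suc k) z" by (simp add: F_def mult_right_mono)
  qed
  have "(\<integral>\<^sup>+z. ennreal (U z) \<partial>circle_lebesgue) \<le> (\<integral>\<^sup>+z. (SUP k. ennreal (F k z)) \<partial>circle_lebesgue)"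
  proof (rule nn_integral_mono_AE, rule AE_mp[OF nz], rule AE_I2, rule impI)
    fix z assume "(\<Prod>j<n. Q j z) \<noteq> 0"
    then have pz: "p z \<noteq> 0" by (simp add: p_def)
    have "(\<lambda>k. v z / (p z + d k) * enn2real (h z)) \<longlonglongrightarrow> v z / (p z + 0) * enn2real (h z)"
      using pz by (intro tendsto_intros dlim) auto
    then have "(\<lambda>k. ennreal (F k z)) \<longlonglongrightarrow> ennreal (U z)"
      by (intro tendsto_ennrealI) (simp add: F_def U_def g_def)
    then show "ennreal (U z) \<le> (SUP k. ennreal (F k z))"
      by (rule LIMSEQ_le_const2) (intro exI allI impI SUP_upper UNIV_I)
  qed
  also have "\<dots> = (SUP k. \<integral>\<^sup>+z. ennreal (F k z) \<partial>circle_lebesgue)"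
    by (rule nn_integral_monotone_convergence_SUP[OF inc Fm])
  also have "\<dots> \<le> ennreal (\<integral>z. v z \<partial>\<nu>)"
  proof (rule SUP_least)
    fix k
    have "(\<integral>\<^sup>+z. ennreal (F k z) \<partial>circle_lebesgue) = ennreal (\<integral>z. F k z \<partial>circle_lebesgue)"
      using F(1) F0 by (intro nn_integral_eq_integral) auto
    then show "(\<integral>\<^sup>+z. ennreal (F k z) \<partial>circle_lebesgue) \<le> ennreal (\<integral>z. v z \<partial>\<nu>)"
      using F(2) by (simp add: ennreal_leI)
  qed
  finally have U: "(\<integral>\<^sup>+z. ennreal (U z) \<partial>circle_lebesgue) \<le> ennreal (\<integral>z. v z \<partial>\<nu>)" .
  have U0: "U z \<ge> 0" for z using v(2) p0 by (simp add: U_def)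
  have Um: "U \<in> borel_measurable circle_lebesgue" unfolding U_def[abs_def] by measurable
  have "integrable circle_lebesgue U"
    using U U0 Um by (intro integrableI_nonneg) (auto simp: le_less_trans)
  moreover from this have "(\<integral>z. U z \<partial>circle_lebesgue) \<le> (\<integral>z. v z \<partial>\<nu>)"
    using U U0 nv by (simp add: nn_integral_eq_integral ennreal_le_iff)
  ultimately show "integrable circle_lebesgue (\<lambda>z. v z * (enn2real (h z) / (cmod (\<Prod>j<n. Q j z))\<^sup>2))"
    "(\<integral>z. v z * (enn2real (h z) / (cmod (\<Prod>j<n. Q j z))\<^sup>2) \<partial>circle_lebesgue) \<le> (\<integral>z. v z \<partial>\<nu>)"
    by (simp_all add: U_def[abs_def] p_def)
qed

text \<open>After a truncation at \<open>K\<close> the square of the error is at most \<open>K\<close> times the error, so the approximation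
  in \<open>L\<^sup>1\<close> applies.\<close>

lemma L2_approx_continuous:
  fixes w :: "complex \<Rightarrow> real"
  assumes w[measurable]: "w \<in> borel_measurable circle_lebesgue" "\<And>z. w z \<ge> 0"
    and w2: "integrable circle_lebesgue (\<lambda>z. (w z)\<^sup>2)" and e: "e > 0"
  obtains v :: "complex \<Rightarrow> real" where "continuous_on (sphere 0 1) v" "\<And>z. v z \<ge> 0"
    "(\<integral>z. (w z - v z)\<^sup>2 \<partial>circle_lebesgue) < e"
proof -
  have "(\<lambda>K::nat. \<integral>z. (w z - min (w z) (real K))\<^sup>2 \<partial>circle_lebesgue) \<longlonglongrightarrow> (\<integral>z. 0 \<partial>circle_lebesgue)"
  proof (rule integral_dominated_convergence[where w = "\<lambda>z. (w z)\<^sup>2"])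
    show "AE z in circle_lebesgue. (\<lambda>K::nat. (w z - min (w z) (real K))\<^sup>2) \<longlonglongrightarrow> 0"
    proof (rule AE_I2)
      fix z
      obtain N :: nat where "w z \<le> N" using real_arch_simple by blast
      then have "\<forall>K\<ge>N. (w z - min (w z) (real K))\<^sup>2 = 0" by (auto simp: min_absorb1)
      then show "(\<lambda>K::nat. (w z - min (w z) (real K))\<^sup>2) \<longlonglongrightarrow> 0"
        by (intro tendsto_eventually) (auto simp: eventually_sequentially)
    qed
    show "AE z in circle_lebesgue. norm ((w z - min (w z) (real K))\<^sup>2) \<le> (w z)\<^sup>2" for K
      using w(2) by (intro AE_I2) (auto simp: min_def intro!: power_mono)
  qed (use w2 in auto)
  then have "(\<lambda>K::nat. \<integral>z. (w z - min (w z) (real K))\<^sup>2 \<partial>circle_lebesgue) \<longlonglongrightarrow> 0" by simp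
  then have "\<forall>\<^sub>F K::nat in sequentially. (\<integral>z. (w z - min (w z) (real K))\<^sup>2 \<partial>circle_lebesgue) < e / 4"
    using e by (intro order_tendstoD) auto
  then obtain K :: nat where K: "(\<integral>z. (w z - min (w z) (real K))\<^sup>2 \<partial>circle_lebesgue) < e / 4"
    by (auto simp: eventually_sequentially)
  define wK where "wK z = min (w z) (real K)" for z
  have wKm[measurable]: "wK \<in> borel_measurable circle_lebesgue" unfolding wK_def by measurable
  have wK: "0 \<le> wK z \<and> wK z \<le> real K" for z using w(2)[of z] by (simp add: wK_def)
  have e': "e / (4 * (real K + 1)) > 0" using e by (simp add: add_nonneg_pos)
  obtain v :: "complex \<Rightarrow> real" where v: "continuous_on (sphere 0 1) v" "\<And>z. 0 \<le> v z \<and> v z \<le> real K"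
    "(\<integral>z. \<bar>wK z - v z\<bar> \<partial>circle_lebesgue) < e / (4 * (real K + 1))"
    using circle_L1_approx_continuous[OF finite_circle_measure_circle_lebesgue
        finite_circle_measure_circle_lebesgue wKm wK e'] by blast
  have [measurable]: "v \<in> borel_measurable circle_lebesgue" using circle_integrable[OF v(1)] by auto
  have b: "\<bar>wK z - v z\<bar> \<le> real K" for z using wK[of z] v(2)[of z] by linarith
  have i1: "integrable circle_lebesgue (\<lambda>z. \<bar>wK z - v z\<bar>)"
    by (rule circle_lebesgue.integrable_const_bound[where B = K]) (use b in auto)
  have b2: "(wK z - v z)\<^sup>2 \<le> real K * \<bar>wK z - v z\<bar>" for z
  proof -
    have "(wK z - v z)\<^sup>2 = \<bar>wK z - v z\<bar> * \<bar>wK z - v z\<bar>" by (simp add: power2_eq_square)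
    also have "\<dots> \<le> real K * \<bar>wK z - v z\<bar>" by (rule mult_right_mono[OF b]) simp
    finally show ?thesis .
  qed
  have i2: "integrable circle_lebesgue (\<lambda>z. (w z - wK z)\<^sup>2)"
    by (rule Bochner_Integration.integrable_bound[OF w2])
      (use w(2) in \<open>auto simp: wK_def min_def intro!: power_mono\<close>)
  have pt: "(w z - v z)\<^sup>2 \<le> 2 * (w z - wK z)\<^sup>2 + 2 * (real K * \<bar>wK z - v z\<bar>)" for z
  proof -
    have "(w z - v z)\<^sup>2 \<le> 2 * (w z - wK z)\<^sup>2 + 2 * (wK z - v z)\<^sup>2"
      using sum_squares_bound[of "w z - wK z" "wK z - v z"] by (simp add: power2_eq_square algebra_simps)
    then show ?thesis using b2[of z] by linarith
  qed
  have i3: "integrable circle_lebesgue (\<lambda>z. 2 * (w z - wK z)\<^sup>2 + 2 * (real K * \<bar>wK z - v z\<bar>))"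
    using i1 i2 by auto
  have "(\<integral>z. (w z - v z)\<^sup>2 \<partial>circle_lebesgue) \<le> (\<integral>z. 2 * (w z - wK z)\<^sup>2 + 2 * (real K * \<bar>wK z - v z\<bar>) \<partial>circle_lebesgue)"
    by (rule integral_mono[OF Bochner_Integration.integrable_bound[OF i3] i3])
      (use pt in \<open>auto intro: order_trans[OF _ abs_ge_self]\<close>)
  also have "\<dots> = 2 * (\<integral>z. (w z - wK z)\<^sup>2 \<partial>circle_lebesgue) + 2 * (real K * (\<integral>z. \<bar>wK z - v z\<bar> \<partial>circle_lebesgue))"
    using i1 i2 by (subst Bochner_Integration.integral_add) auto
  also have "\<dots> < 2 * (e / 4) + 2 * (e / 4)"
  proof (rule add_less_le_mono)
    show "2 * (\<integral>z. (w z - wK z)\<^sup>2 \<partial>circle_lebesgue) < 2 * (e / 4)" using K by (simp add: wK_def)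
    have "real K * (\<integral>z. \<bar>wK z - v z\<bar> \<partial>circle_lebesgue) \<le> (real K + 1) * (e / (4 * (real K + 1)))"
      using v(3) e by (intro mult_mono) auto
    also have "\<dots> = e / 4" by (simp add: field_simps)
    finally show "2 * (real K * (\<integral>z. \<bar>wK z - v z\<bar> \<partial>circle_lebesgue)) \<le> 2 * (e / 4)" by simp
  qed
  finally show ?thesis using that[OF v(1)] v(2) by auto
qed


section \<open>The moduli of the partial products converge in mean\<close>

lemma frequently_le_tendsto:
  fixes c :: real
  assumes "\<exists>\<^sub>F n in sequentially. c \<le> X n" "\<And>n. X n \<le> Y n" "Y \<longlonglongrightarrow> l"
  shows "c \<le> l"
proof (rule ccontr)
  assume "\<not> c \<le> l"
  then have "\<forall>\<^sub>F n in sequentially. Y n < c" using assms(3) by (intro order_tendstoD) auto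
  then have "\<forall>\<^sub>F n in sequentially. \<not> c \<le> X n"
    by (rule eventually_mono) (use assms(2) in \<open>meson not_le order_le_less_trans\<close>)
  with assms(1) show False by (simp add: frequently_def)
qed

lemma mult_add_inverse_bound:
  fixes f \<theta> :: real
  assumes "\<theta> > 0"
  shows "2 * f \<le> f\<^sup>2 * \<theta> + 1 / \<theta>"
proof -
  have "f\<^sup>2 * \<theta> + 1 / \<theta> - 2 * f = (f * \<theta> - 1)\<^sup>2 / \<theta>"
    using assms by (simp add: field_simps power2_eq_square)
  moreover have "\<dots> \<ge> 0" using assms by simp
  ultimately show ?thesis by linarith
qed

lemma abs_inverse_diff_le:
  fixes a :: real
  assumes "a > 0" "x \<ge> a" "y \<ge> a"
  shows "\<bar>1 / x - 1 / y\<bar> \<le> (1 / a\<^sup>2) * \<bar>x - y\<bar>"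
proof -
  have "1 / x - 1 / y = (y - x) / (x * y)" using assms by (simp add: field_simps)
  then have "\<bar>1 / x - 1 / y\<bar> = \<bar>x - y\<bar> / (x * y)"
    using assms by (simp add: abs_mult abs_minus_commute)
  also have "\<dots> \<le> \<bar>x - y\<bar> / a\<^sup>2"
    using assms by (intro divide_left_mono) (auto simp: power2_eq_square intro!: mult_mono mult_pos_pos)
  finally show ?thesis by simp
qed

lemma clipped_quotient_bound:
  fixes w d :: real
  assumes "w \<ge> 0" "0 < d" "d \<le> 1"
  defines "c \<equiv> max d (min w (1 / d))"
  shows "1 / c * w\<^sup>2 \<le> w + d * w\<^sup>2" "c \<le> w + d"
proof -
  have c0: "c > 0" using assms by (simp add: c_def)
  have dd: "d \<le> 1 / d" using assms(2,3) by (simp add: field_simps mult_le_one)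
  show "c \<le> w + d" using assms by (auto simp: c_def min_def max_def)
  have "w \<le> c \<or> c = 1 / d" using dd by (cases "w \<le> 1 / d") (simp_all add: c_def max_absorb2)
  then consider "w \<le> c" | "c = 1 / d" by blast
  then show "1 / c * w\<^sup>2 \<le> w + d * w\<^sup>2"
  proof cases
    case 1
    have "w\<^sup>2 \<le> w * c" using 1 assms(1) by (simp add: power2_eq_square mult_left_mono)
    then have "1 / c * w\<^sup>2 \<le> w" using c0 by (simp add: divide_le_eq)
    moreover have "d * w\<^sup>2 \<ge> 0" using assms(2) by simp
    ultimately show ?thesis by linarith
  qed (use assms(1,2) in auto)
qed

text \<open>For every \<open>\<theta> > 0\<close> one has \<open>2 f \<le> f\<^sup>2 \<theta> + 1 / \<theta>\<close>, with equality at \<open>\<theta> = 1 / f\<close>.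
  Integrating with a continuous \<open>\<theta>\<close> allows the passage to the weak limit on the right, and the optimal \<open>\<theta>\<close> in
  the limit is \<open>1 / sqrt h\<close> off the singular part, up to truncation.\<close>

lemma eventually_integral_product_le:
  assumes Q: "\<And>j. continuous_on (sphere 0 1) (Q j)" and \<mu>: "is_product_measure Q \<mu>"
    and 1: "\<And>n. (\<integral>z. (cmod (\<Prod>j<n. Q j z))\<^sup>2 \<partial>circle_lebesgue) = 1"
    and h: "is_ac_density circle_lebesgue \<mu> h" and e: "e > 0"
  shows "\<forall>\<^sub>F n in sequentially. (\<integral>z. cmod (\<Prod>j<n. Q j z) \<partial>circle_lebesgue)
      \<le> (\<integral>z. sqrt (enn2real (h z)) \<partial>circle_lebesgue) + e"
proof (rule ccontr)
  assume neg: "\<not> ?thesis"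
  define w where "w z = sqrt (enn2real (h z))" for z
  have fc: "finite_circle_measure \<mu>" using \<mu> by (auto simp: is_product_measure_def)
  interpret \<mu>: finite_measure \<mu> using finite_circle_measureD[OF fc] by simp
  have hm[measurable]: "h \<in> borel_measurable circle_lebesgue" using h by (auto simp: is_ac_density_def)
  have wm[measurable]: "w \<in> borel_measurable circle_lebesgue" unfolding w_def by measurable
  have w0: "w z \<ge> 0" for z by (simp add: w_def)
  have w2: "enn2real (h z) = (w z)\<^sup>2" for z by (simp add: w_def)
  note mass = product_measure_mass[OF Q \<mu> 1]
  have ih: "integrable circle_lebesgue (\<lambda>z. (w z)\<^sup>2)" "(\<integral>z. (w z)\<^sup>2 \<partial>circle_lebesgue) \<le> 1"
    using ac_density_integral_le[OF h \<mu>.finite_measure_axioms, of "\<lambda>_. 1"] mass by (auto simp: w2)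
  have iw: "integrable circle_lebesgue w"
  proof (rule Bochner_Integration.integrable_bound)
    show "integrable circle_lebesgue (\<lambda>z. 1 + (w z)\<^sup>2)" using ih by auto
    have "w z \<le> 1 + (w z)\<^sup>2" for z using sum_squares_bound[of 1 "w z"] w0[of z] by (simp add: power2_eq_square)
    then show "AE z in circle_lebesgue. norm (w z) \<le> norm (1 + (w z)\<^sup>2)" using w0 by (intro AE_I2) auto
  qed (rule wm)
  define d where "d = min 1 (e / 3)"
  have d: "0 < d" "d \<le> 1" "3 * d \<le> e" using e by (auto simp: d_def)
  define c where "c z = max d (min (w z) (1 / d))" for z
  have dd: "d \<le> 1 / d" using d by (simp add: field_simps mult_le_one)
  have c: "d \<le> c z \<and> c z \<le> 1 / d" for z using dd by (auto simp: c_def)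
  have cp: "c z > 0" for z using c[of z] d(1) by linarith
  have cm[measurable]: "c \<in> borel_measurable circle_lebesgue" unfolding c_def by measurable
  have ci: "integrable circle_lebesgue c"
    by (rule circle_lebesgue.integrable_const_bound[where B = "1 / d"])
      (use c cp cm in \<open>auto simp: abs_of_pos\<close>)
  have r: "d \<le> 1 / c z \<and> 1 / c z \<le> 1 / d" for z
    using c[of z] cp[of z] d(1) by (simp add: field_simps)
  have "2 * ((\<integral>z. w z \<partial>circle_lebesgue) + e) \<le> d * measure \<mu> (space \<mu>)
      + (\<integral>z. 1 / c z * enn2real (h z) \<partial>circle_lebesgue) + (\<integral>z. 1 / (1 / c z) \<partial>circle_lebesgue)"
  proof (rule continuous_test_inequality_extends[OF h fc, where b = "1 / d" and L = "1 / d\<^sup>2"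
        and \<theta> = "\<lambda>z. 1 / c z"])
    show "\<bar>1 / x - 1 / y\<bar> \<le> 1 / d\<^sup>2 * \<bar>x - y\<bar>" if "x \<in> {d..1 / d}" "y \<in> {d..1 / d}" for x y
      using that d(1) by (intro abs_inverse_diff_le) auto
    show "continuous_on {d..1 / d} ((/) 1)" using d(1) by (intro continuous_intros) auto
    fix \<theta> :: "complex \<Rightarrow> real" assume \<theta>: "continuous_on (sphere 0 1) \<theta>" "\<And>z. d \<le> \<theta> z \<and> \<theta> z \<le> 1 / d"
    have \<theta>0: "\<theta> z > 0" for z using \<theta>(2)[of z] d(1) by linarith
    have c\<theta>: "continuous_on (sphere 0 1) (\<lambda>z. 1 / \<theta> z)"
      by (intro continuous_intros \<theta>(1)) (metis \<theta>0 less_irrefl)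
    have lim: "(\<lambda>n. (\<integral>z. (cmod (\<Prod>j<n. Q j z))\<^sup>2 * \<theta> z \<partial>circle_lebesgue) + (\<integral>z. 1 / \<theta> z \<partial>circle_lebesgue))
        \<longlonglongrightarrow> (\<integral>z. \<theta> z \<partial>\<mu>) + (\<integral>z. 1 / \<theta> z \<partial>circle_lebesgue)"
      by (intro tendsto_intros product_measure_integral_tendsto[OF Q \<mu> \<theta>(1)])
    show "2 * ((\<integral>z. w z \<partial>circle_lebesgue) + e) \<le> (\<integral>z. \<theta> z \<partial>\<mu>) + (\<integral>z. 1 / \<theta> z \<partial>circle_lebesgue)"
    proof (rule frequently_le_tendsto[OF _ _ lim])
      show "\<exists>\<^sub>F n in sequentially. 2 * ((\<integral>z. w z \<partial>circle_lebesgue) + e) \<le> 2 * (\<integral>z. cmod (\<Prod>j<n. Q j z) \<partial>circle_lebesgue)"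
        using neg unfolding not_eventually w_def by (rule frequently_elim1) simp
      fix n
      have i: "integrable circle_lebesgue (\<lambda>z. cmod (\<Prod>j<n. Q j z))"
        "integrable circle_lebesgue (\<lambda>z. (cmod (\<Prod>j<n. Q j z))\<^sup>2 * \<theta> z)" "integrable circle_lebesgue (\<lambda>z. 1 / \<theta> z)"
        by (intro circle_integrable continuous_intros Q c\<theta> \<theta>(1))+
      have "2 * (\<integral>z. cmod (\<Prod>j<n. Q j z) \<partial>circle_lebesgue) = (\<integral>z. 2 * cmod (\<Prod>j<n. Q j z) \<partial>circle_lebesgue)" by simp
      also have "\<dots> \<le> (\<integral>z. (cmod (\<Prod>j<n. Q j z))\<^sup>2 * \<theta> z + 1 / \<theta> z \<partial>circle_lebesgue)"
        using i mult_add_inverse_bound[OF \<theta>0] by (intro integral_mono) auto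
      also have "\<dots> = (\<integral>z. (cmod (\<Prod>j<n. Q j z))\<^sup>2 * \<theta> z \<partial>circle_lebesgue) + (\<integral>z. 1 / \<theta> z \<partial>circle_lebesgue)"
        using i by simp
      finally show "2 * (\<integral>z. cmod (\<Prod>j<n. Q j z) \<partial>circle_lebesgue)
        \<le> (\<integral>z. (cmod (\<Prod>j<n. Q j z))\<^sup>2 * \<theta> z \<partial>circle_lebesgue) + (\<integral>z. 1 / \<theta> z \<partial>circle_lebesgue)" .
    qed
  qed (use r d(1) in auto)
  also have "(\<integral>z. 1 / c z * enn2real (h z) \<partial>circle_lebesgue) \<le> (\<integral>z. w z + d * (w z)\<^sup>2 \<partial>circle_lebesgue)"
  proof (rule integral_mono)
    show "1 / c z * enn2real (h z) \<le> w z + d * (w z)\<^sup>2" for z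
      unfolding w2 c_def by (rule clipped_quotient_bound(1)[OF w0 d(1,2)])
    show i: "integrable circle_lebesgue (\<lambda>z. w z + d * (w z)\<^sup>2)" using iw ih by auto
    show "integrable circle_lebesgue (\<lambda>z. 1 / c z * enn2real (h z))"
    proof (rule Bochner_Integration.integrable_bound[OF i])
      show "AE z in circle_lebesgue. norm (1 / c z * enn2real (h z)) \<le> norm (w z + d * (w z)\<^sup>2)"
      proof (rule AE_I2)
        fix z
        have "0 \<le> 1 / c z * (w z)\<^sup>2" using cp[of z] by simp
        moreover have "1 / c z * (w z)\<^sup>2 \<le> w z + d * (w z)\<^sup>2"
          unfolding c_def by (rule clipped_quotient_bound(1)[OF w0 d(1,2)])
        ultimately show "norm (1 / c z * enn2real (h z)) \<le> norm (w z + d * (w z)\<^sup>2)"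
          unfolding w2 by simp
      qed
    qed measurable
  qed
  also have "(\<integral>z. w z + d * (w z)\<^sup>2 \<partial>circle_lebesgue) = (\<integral>z. w z \<partial>circle_lebesgue) + d * (\<integral>z. (w z)\<^sup>2 \<partial>circle_lebesgue)"
    using iw ih by simp
  also have "(\<integral>z. 1 / (1 / c z) \<partial>circle_lebesgue) \<le> (\<integral>z. w z + d \<partial>circle_lebesgue)"
    using iw ci clipped_quotient_bound(2)[OF w0 d(1,2)] by (intro integral_mono) (auto simp: c_def[symmetric])
  also have "\<dots> = (\<integral>z. w z \<partial>circle_lebesgue) + d" using iw by simp
  finally have "2 * ((\<integral>z. w z \<partial>circle_lebesgue) + e)
    \<le> d + ((\<integral>z. w z \<partial>circle_lebesgue) + d * (\<integral>z. (w z)\<^sup>2 \<partial>circle_lebesgue)) + ((\<integral>z. w z \<partial>circle_lebesgue) + d)"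
    by (simp add: mass)
  moreover have "d * (\<integral>z. (w z)\<^sup>2 \<partial>circle_lebesgue) \<le> d * 1" by (rule mult_left_mono[OF ih(2)]) (use d in simp)
  ultimately show False using d(3) e by (simp add: algebra_simps)
qed

text \<open>This is where class (L) enters: with \<open>u\<^sup>2\<close> the density of the tail, the mean of a fixed
  continuous \<open>v\<close> against \<open>u \<le> (1 + u\<^sup>2) / 2\<close> is asymptotically at most \<open>\<integral> v\<close>, because the
  tails converge weakly to Lebesgue measure. The square root of \<open>h\<close> is replaced by such a \<open>v\<close> up to a small
  \<open>L\<^sup>2\<close> error, which is harmless as \<open>\<integral> u\<^sup>2 \<le> 1\<close>.\<close>

lemma eventually_integral_tail_le:
  assumes Q: "\<And>j. continuous_on (sphere 0 1) (Q j)" and \<mu>: "is_product_measure Q \<mu>"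
    and 1: "\<And>n m. (\<integral>z. (cmod (\<Prod>j<m. Q (n + j) z))\<^sup>2 \<partial>circle_lebesgue) = 1"
    and h: "is_ac_density circle_lebesgue \<mu> h"
    and \<nu>: "\<And>n. is_product_measure (\<lambda>j. Q (n + j)) (\<nu> n)"
    and lim: "weakly_converges \<nu> circle_lebesgue"
    and nz: "\<And>n. AE z in circle_lebesgue. (\<Prod>j<n. Q j z) \<noteq> 0" and e: "e > 0"
  shows "\<forall>\<^sub>F n in sequentially. (\<integral>z. enn2real (h z) / cmod (\<Prod>j<n. Q j z) \<partial>circle_lebesgue)
      \<le> (\<integral>z. sqrt (enn2real (h z)) \<partial>circle_lebesgue) + e"
    and "integrable circle_lebesgue (\<lambda>z. enn2real (h z) / cmod (\<Prod>j<n. Q j z))"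
proof -
  define w where "w z = sqrt (enn2real (h z))" for z
  define f where "f n z = cmod (\<Prod>j<n. Q j z)" for n z
  define u where "u n z = w z / f n z" for n z
  have fc: "finite_circle_measure \<mu>" using \<mu> by (auto simp: is_product_measure_def)
  interpret \<mu>: finite_measure \<mu> using finite_circle_measureD[OF fc] by simp
  have hm[measurable]: "h \<in> borel_measurable circle_lebesgue" using h by (auto simp: is_ac_density_def)
  have wm[measurable]: "w \<in> borel_measurable circle_lebesgue" unfolding w_def by measurable
  have fcont: "continuous_on (sphere 0 1) (f n)" for n unfolding f_def by (intro continuous_intros Q)
  have fm[measurable]: "f n \<in> borel_measurable circle_lebesgue" for n using circle_integrable[OF fcont] by auto
  have um[measurable]: "u n \<in> borel_measurable circle_lebesgue" for n unfolding u_def by measurable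
  have w0: "w z \<ge> 0" and f0: "f n z \<ge> 0" and u0: "u n z \<ge> 0" for z n by (auto simp: w_def f_def u_def)
  have w2: "enn2real (h z) = (w z)\<^sup>2" for z by (simp add: w_def)
  have wu: "enn2real (h z) / f n z = w z * u n z" for n z by (simp add: w2 u_def power2_eq_square)
  have u2: "enn2real (h z) / (f n z)\<^sup>2 = (u n z)\<^sup>2" for n z by (simp add: w2 u_def power_divide)
  have ih: "integrable circle_lebesgue (\<lambda>z. (w z)\<^sup>2)"
    using ac_density_integral_le[OF h \<mu>.finite_measure_axioms, of "\<lambda>_. 1"] by (auto simp: w2)
  have mass: "measure (\<nu> n) (space (\<nu> n)) = 1" for n
    by (rule product_measure_mass[OF Q \<nu> 1])
  have fn: "finite_circle_measure (\<nu> n)" for n using \<nu>[of n] by (auto simp: is_product_measure_def)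
  have tail: "integrable circle_lebesgue (\<lambda>z. v z * (u n z)\<^sup>2)"
      "(\<integral>z. v z * (u n z)\<^sup>2 \<partial>circle_lebesgue) \<le> (\<integral>z. v z \<partial>\<nu> n)"
    if "continuous_on (sphere 0 1) v" "\<And>z. v z \<ge> 0" for v n
    using tail_density_integral_le[OF Q \<mu> h \<nu> nz that] by (simp_all add: f_def[symmetric] u2)
  have iu: "integrable circle_lebesgue (\<lambda>z. (u n z)\<^sup>2)" "(\<integral>z. (u n z)\<^sup>2 \<partial>circle_lebesgue) \<le> 1" for n
    using tail[of "\<lambda>_. 1" n] mass[of n] by auto
  have ae: "x * y \<le> (x\<^sup>2 + y\<^sup>2) / 2" for x y :: real
    using sum_squares_bound[of x y] by simp
  have iwu: "integrable circle_lebesgue (\<lambda>z. w z * u n z)" for n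
    by (rule Bochner_Integration.integrable_bound[of _ "\<lambda>z. ((w z)\<^sup>2 + (u n z)\<^sup>2) / 2"])
      (use ih iu ae w0 u0 in \<open>auto intro!: AE_I2 simp: abs_of_nonneg\<close>)
  then show "integrable circle_lebesgue (\<lambda>z. enn2real (h z) / cmod (\<Prod>j<n. Q j z))"
    using wu[of _ n] by (simp add: f_def[symmetric])
  have iw: "integrable circle_lebesgue w"
    by (rule Bochner_Integration.integrable_bound[of _ "\<lambda>z. ((w z)\<^sup>2 + 1\<^sup>2) / 2"])
      (use ih ae[of "w _" 1] w0 in \<open>auto intro!: AE_I2 simp: abs_of_nonneg\<close>)
  define s where "s = e / 3"
  have s: "s > 0" using e by (simp add: s_def)
  then have s2: "s\<^sup>2 > 0" by simp
  obtain v :: "complex \<Rightarrow> real" where v: "continuous_on (sphere 0 1) v" "\<And>z. v z \<ge> 0"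
    "(\<integral>z. (w z - v z)\<^sup>2 \<partial>circle_lebesgue) < s\<^sup>2"
    by (rule L2_approx_continuous[OF wm w0 ih s2]) (rule that)
  have iv: "integrable circle_lebesgue v" "integrable circle_lebesgue (\<lambda>z. (v z)\<^sup>2)"
    by (intro circle_integrable continuous_intros v)+
  have [measurable]: "v \<in> borel_measurable circle_lebesgue" using iv by auto
  have iwv: "integrable circle_lebesgue (\<lambda>z. (w z - v z)\<^sup>2)"
  proof (rule Bochner_Integration.integrable_bound)
    show "integrable circle_lebesgue (\<lambda>z. 2 * (w z)\<^sup>2 + 2 * (v z)\<^sup>2)" using ih iv by auto
    have "(w z - v z)\<^sup>2 \<le> 2 * (w z)\<^sup>2 + 2 * (v z)\<^sup>2" for z
      using zero_le_power2[of "w z + v z"] by (simp add: power2_eq_square algebra_simps)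
    then show "AE z in circle_lebesgue. norm ((w z - v z)\<^sup>2) \<le> norm (2 * (w z)\<^sup>2 + 2 * (v z)\<^sup>2)"
      by (intro AE_I2) auto
  qed measurable
  \<comment> \<open>The weight \<open>s\<close> balances the two factors of the error term \<open>\<bar>w - v\<bar> u\<close>: the first has mean square
    below \<open>s\<^sup>2\<close>, the second at most \<open>1\<close>, and so the contribution is at most \<open>s\<close>.\<close>
  have split: "\<bar>x\<bar> * y \<le> (x\<^sup>2 / s + s * y\<^sup>2) / 2" if "y \<ge> 0" for x y
  proof -
    have "x\<^sup>2 / s + s * y\<^sup>2 - 2 * (\<bar>x\<bar> * y) = (\<bar>x\<bar> - s * y)\<^sup>2 / s"
      using s by (simp add: field_simps power2_eq_square)
    moreover have "\<dots> \<ge> 0" using s by simp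
    ultimately show ?thesis by simp
  qed
  have vw: "(\<integral>z. v z \<partial>circle_lebesgue) \<le> (\<integral>z. w z \<partial>circle_lebesgue) + s"
  proof -
    have "(\<integral>z. v z \<partial>circle_lebesgue) \<le> (\<integral>z. w z + ((w z - v z)\<^sup>2 / s + s * 1\<^sup>2) / 2 \<partial>circle_lebesgue)"
    proof (rule integral_mono)
      show "v z \<le> w z + ((w z - v z)\<^sup>2 / s + s * 1\<^sup>2) / 2" for z
      proof -
        have "\<bar>w z - v z\<bar> \<le> ((w z - v z)\<^sup>2 / s + s * 1\<^sup>2) / 2"
          using split[of 1 "w z - v z"] by simp
        moreover have "b \<le> a + X" if "\<bar>a - b\<bar> \<le> X" for a b X :: real using that by linarith
        ultimately show ?thesis by blast
      qed
    qed (use iv iw iwv in auto)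
    also have "\<dots> = (\<integral>z. w z \<partial>circle_lebesgue) + ((\<integral>z. (w z - v z)\<^sup>2 \<partial>circle_lebesgue) / s + s) / 2"
      using iw iwv by simp
    also have "(\<integral>z. (w z - v z)\<^sup>2 \<partial>circle_lebesgue) / s \<le> s\<^sup>2 / s"
      using v(3) s by (intro divide_right_mono) auto
    also have "s\<^sup>2 / s = s" using s by (simp add: power2_eq_square)
    finally show ?thesis by simp
  qed
  have main: "(\<integral>z. w z * u n z \<partial>circle_lebesgue)
      \<le> ((\<integral>z. v z \<partial>circle_lebesgue) + (\<integral>z. v z \<partial>\<nu> n)) / 2 + s" for n
  proof -
    note ivu = tail[OF v(1,2), of n]
    have "(\<integral>z. w z * u n z \<partial>circle_lebesgue)
      \<le> (\<integral>z. (v z + v z * (u n z)\<^sup>2) / 2 + ((w z - v z)\<^sup>2 / s + s * (u n z)\<^sup>2) / 2 \<partial>circle_lebesgue)"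
    proof (rule integral_mono)
      fix z
      have "w z * u n z = v z * u n z + (w z - v z) * u n z" by (simp add: algebra_simps)
      also have "v z * u n z \<le> v z * ((1 + (u n z)\<^sup>2) / 2)"
        using ae[of 1 "u n z"] v(2) by (intro mult_left_mono) auto
      also have "(w z - v z) * u n z \<le> \<bar>w z - v z\<bar> * u n z" using u0 by (intro mult_right_mono) auto
      also have "\<dots> \<le> ((w z - v z)\<^sup>2 / s + s * (u n z)\<^sup>2) / 2" by (rule split[OF u0])
      finally show "w z * u n z \<le> (v z + v z * (u n z)\<^sup>2) / 2 + ((w z - v z)\<^sup>2 / s + s * (u n z)\<^sup>2) / 2"
        by (simp add: algebra_simps add_divide_distrib)
    qed (use iwu iv iwv iu ivu in auto)
    also have "\<dots> = ((\<integral>z. v z \<partial>circle_lebesgue) + (\<integral>z. v z * (u n z)\<^sup>2 \<partial>circle_lebesgue)) / 2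
        + ((\<integral>z. (w z - v z)\<^sup>2 \<partial>circle_lebesgue) / s + s * (\<integral>z. (u n z)\<^sup>2 \<partial>circle_lebesgue)) / 2"
      using iv iwv iu ivu by simp
    also have "\<dots> \<le> ((\<integral>z. v z \<partial>circle_lebesgue) + (\<integral>z. v z \<partial>\<nu> n)) / 2 + (s\<^sup>2 / s + s * 1) / 2"
      using v(3) s iu(2)[of n] ivu(2)
      by (intro add_mono divide_right_mono mult_left_mono) auto
    also have "s\<^sup>2 / s = s" using s by (simp add: power2_eq_square)
    finally show ?thesis by simp
  qed
  have "(\<lambda>n. ((\<integral>z. v z \<partial>circle_lebesgue) + (\<integral>z. v z \<partial>\<nu> n)) / 2 + s)
      \<longlonglongrightarrow> ((\<integral>z. v z \<partial>circle_lebesgue) + (\<integral>z. v z \<partial>circle_lebesgue)) / 2 + s"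
    using lim v(1) by (intro tendsto_intros) (auto simp: weakly_converges_def)
  moreover have "((\<integral>z. v z \<partial>circle_lebesgue) + (\<integral>z. v z \<partial>circle_lebesgue)) / 2 + s < (\<integral>z. w z \<partial>circle_lebesgue) + e"
    using vw s by (simp add: s_def)
  ultimately have "\<forall>\<^sub>F n in sequentially. ((\<integral>z. v z \<partial>circle_lebesgue) + (\<integral>z. v z \<partial>\<nu> n)) / 2 + s
      < (\<integral>z. w z \<partial>circle_lebesgue) + e"
    by (rule order_tendstoD)
  then have "\<forall>\<^sub>F n in sequentially. (\<integral>z. w z * u n z \<partial>circle_lebesgue) \<le> (\<integral>z. w z \<partial>circle_lebesgue) + e"
    by (rule eventually_mono) (use main in \<open>meson less_imp_le order_le_less_trans\<close>)
  then show "\<forall>\<^sub>F n in sequentially. (\<integral>z. enn2real (h z) / cmod (\<Prod>j<n. Q j z) \<partial>circle_lebesgue)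
      \<le> (\<integral>z. sqrt (enn2real (h z)) \<partial>circle_lebesgue) + e"
    by (simp only: f_def[symmetric] w_def[symmetric] wu)
qed

text \<open>Write \<open>f\<close> for the modulus of the partial product, \<open>w = sqrt h\<close> and \<open>u = w / f\<close>, so that
  \<open>u\<^sup>2\<close> is the density of the tail. The two preceding bounds add up to a bound for the integral of
  \<open>f + w u - 2 w = f (1 - u)\<^sup>2\<close>, and \<open>\<bar>f - w\<bar> = f \<bar>1 - u\<bar>\<close> is
  controlled by \<open>f (1 - u)\<^sup>2\<close> and \<open>\<integral> f \<le> 1\<close>.\<close>

theorem partial_product_converges_in_mean:
  assumes Q: "generalized_riesz_product Q \<mu>" and L: "class_L Q"
    and h: "is_ac_density circle_lebesgue \<mu> h"
    and nz: "\<And>n. AE z in circle_lebesgue. (\<Prod>j<n. Q j z) \<noteq> 0"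
  shows "integrable circle_lebesgue (\<lambda>z. sqrt (enn2real (h z)))"
    and "(\<lambda>n. \<integral>z. \<bar>cmod (\<Prod>j<n. Q j z) - sqrt (enn2real (h z))\<bar> \<partial>circle_lebesgue) \<longlonglongrightarrow> 0"
proof -
  have Qc: "continuous_on (sphere 0 1) (Q j)" for j
    using Q by (auto simp: generalized_riesz_product_def defines_generalized_riesz_product_def
        intro: trig_polynomial_continuous)
  have \<mu>: "is_product_measure Q \<mu>" using Q by (simp add: generalized_riesz_product_def)
  have norm1: "(\<integral>z. (cmod (\<Prod>i\<in>I. Q i z))\<^sup>2 \<partial>circle_lebesgue) = 1" if "finite I" for I
    using Q that by (simp add: generalized_riesz_product_def defines_generalized_riesz_product_def)
  have 1: "(\<integral>z. (cmod (\<Prod>j<m. Q (n + j) z))\<^sup>2 \<partial>circle_lebesgue) = 1" for n m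
    using norm1[of "(+) n ` {..<m}"] by (simp add: prod.reindex)
  have 11: "(\<integral>z. (cmod (\<Prod>j<m. Q j z))\<^sup>2 \<partial>circle_lebesgue) = 1" for m
    using norm1[of "{..<m}"] by simp
  have "\<exists>\<nu>. is_product_measure (\<lambda>j. Q (n + j)) \<nu>" for n
    using Q by (auto simp: generalized_riesz_product_def defines_generalized_riesz_product_def strict_mono_def)
  then obtain \<nu> where \<nu>: "\<And>n. is_product_measure (\<lambda>j. Q (n + j)) (\<nu> n)" by metis
  have lim: "weakly_converges \<nu> circle_lebesgue"
    using L[unfolded class_L_def, rule_format, of "\<lambda>n. n" \<nu>] \<nu> by (simp add: strict_mono_def)
  define w where "w z = sqrt (enn2real (h z))" for z
  define f where "f n z = cmod (\<Prod>j<n. Q j z)" for n z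
  define k where "k n z = enn2real (h z) / f n z" for n z
  have fcont: "continuous_on (sphere 0 1) (f n)" for n unfolding f_def by (intro continuous_intros Qc)
  have i_f: "integrable circle_lebesgue (f n)" "integrable circle_lebesgue (\<lambda>z. (f n z)\<^sup>2)" for n
    by (intro circle_integrable continuous_intros fcont)+
  have f1: "(\<integral>z. f n z \<partial>circle_lebesgue) \<le> 1" for n
  proof -
    have "(\<integral>z. f n z \<partial>circle_lebesgue) \<le> (\<integral>z. ((f n z)\<^sup>2 + 1) / 2 \<partial>circle_lebesgue)"
    proof (rule integral_mono)
      show "f n z \<le> ((f n z)\<^sup>2 + 1) / 2" for z using sum_squares_bound[of "f n z" 1] by simp
    qed (use i_f in auto)
    also have "\<dots> = 1" using i_f 11[of n] by (simp add: f_def)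
    finally show ?thesis .
  qed
  have ik: "integrable circle_lebesgue (k n)" for n
    using eventually_integral_tail_le(2)[OF Qc \<mu> 1 h \<nu> lim nz zero_less_one] by (simp add: k_def[abs_def] f_def)
  have iw: "integrable circle_lebesgue w"
    using eventually_integral_tail_le(2)[OF Qc \<mu> 1 h \<nu> lim nz zero_less_one, of 0]
  proof (rule Bochner_Integration.integrable_bound[OF Bochner_Integration.integrable_add[OF circle_lebesgue.integrable_const]])
    have "h \<in> borel_measurable circle_lebesgue" using h by (auto simp: is_ac_density_def)
    then show "w \<in> borel_measurable circle_lebesgue" unfolding w_def by measurable
    have "x \<le> 1 + x\<^sup>2" if "x \<ge> 0" for x :: real
      using sum_squares_bound[of x 1] that by (simp add: power2_eq_square)
    from this[of "w _"] show "AE z in circle_lebesgue. norm (w z) \<le> norm (1 + enn2real (h z) / cmod (\<Prod>j<0. Q j z))"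
      by (intro AE_I2) (simp add: w_def)
  qed
  then show "integrable circle_lebesgue (\<lambda>z. sqrt (enn2real (h z)))" by (simp add: w_def[abs_def])
  have pt: "\<bar>f n z - w z\<bar> \<le> (s * f n z + (f n z + k n z - 2 * w z) / s) / 2"
    if "f n z \<noteq> 0" "s > 0" for n z s
  proof -
    have fp: "f n z > 0" using that(1) by (simp add: f_def)
    have "f n z + k n z - 2 * w z = (f n z - w z)\<^sup>2 / f n z"
      using fp by (simp add: k_def w_def field_simps power2_eq_square)
    moreover have "2 * \<bar>f n z - w z\<bar> \<le> s * f n z + (f n z - w z)\<^sup>2 / f n z / s"
    proof -
      have "s * f n z + (f n z - w z)\<^sup>2 / f n z / s - 2 * \<bar>f n z - w z\<bar> = (s * f n z - \<bar>f n z - w z\<bar>)\<^sup>2 / (f n z * s)"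
        using fp that(2) by (simp add: field_simps power2_eq_square)
      moreover have "\<dots> \<ge> 0" using fp that(2) by simp
      ultimately show ?thesis by linarith
    qed
    ultimately show ?thesis by simp
  qed
  have bound: "(\<integral>z. \<bar>f n z - w z\<bar> \<partial>circle_lebesgue) \<le>
      (s + ((\<integral>z. f n z \<partial>circle_lebesgue) + (\<integral>z. k n z \<partial>circle_lebesgue) - 2 * (\<integral>z. w z \<partial>circle_lebesgue)) / s) / 2"
    if s: "s > 0" for n s
  proof -
    have "(\<integral>z. \<bar>f n z - w z\<bar> \<partial>circle_lebesgue) \<le> (\<integral>z. (s * f n z + (f n z + k n z - 2 * w z) / s) / 2 \<partial>circle_lebesgue)"
    proof (rule integral_mono_AE)
      have "AE z in circle_lebesgue. f n z \<noteq> 0" using nz[of n] by (simp only: f_def norm_eq_zero not_False_eq_True)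
      then show "AE z in circle_lebesgue. \<bar>f n z - w z\<bar> \<le> (s * f n z + (f n z + k n z - 2 * w z) / s) / 2"
        by (rule eventually_mono) (rule pt[OF _ s])
    qed (use i_f ik iw in auto)
    also have "\<dots> = (s * (\<integral>z. f n z \<partial>circle_lebesgue)
        + ((\<integral>z. f n z \<partial>circle_lebesgue) + (\<integral>z. k n z \<partial>circle_lebesgue) - 2 * (\<integral>z. w z \<partial>circle_lebesgue)) / s) / 2"
      using i_f ik iw by simp
    also have "s * (\<integral>z. f n z \<partial>circle_lebesgue) \<le> s * 1" using f1 s by (intro mult_left_mono) auto
    finally show ?thesis by simp
  qed
  have "(\<lambda>n. \<integral>z. \<bar>f n z - w z\<bar> \<partial>circle_lebesgue) \<longlonglongrightarrow> 0"
  proof (rule LIMSEQ_I)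
    fix e :: real assume e: "e > 0"
    then have e2: "e\<^sup>2 / 4 > 0" by simp
    have "\<forall>\<^sub>F n in sequentially. (\<integral>z. f n z \<partial>circle_lebesgue) \<le> (\<integral>z. w z \<partial>circle_lebesgue) + e\<^sup>2 / 4"
      using eventually_integral_product_le[OF Qc \<mu> 11 h e2] by (simp add: f_def w_def)
    moreover have "\<forall>\<^sub>F n in sequentially. (\<integral>z. k n z \<partial>circle_lebesgue) \<le> (\<integral>z. w z \<partial>circle_lebesgue) + e\<^sup>2 / 4"
      using eventually_integral_tail_le(1)[OF Qc \<mu> 1 h \<nu> lim nz e2] by (simp add: f_def k_def w_def)
    ultimately have "\<forall>\<^sub>F n in sequentially. (\<integral>z. \<bar>f n z - w z\<bar> \<partial>circle_lebesgue) < e"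
    proof eventually_elim
      case (elim n)
      have "(\<integral>z. \<bar>f n z - w z\<bar> \<partial>circle_lebesgue) \<le>
        (e + ((\<integral>z. f n z \<partial>circle_lebesgue) + (\<integral>z. k n z \<partial>circle_lebesgue) - 2 * (\<integral>z. w z \<partial>circle_lebesgue)) / e) / 2"
        by (rule bound[OF e])
      also have "\<dots> \<le> (e + (e\<^sup>2 / 2) / e) / 2"
        using elim e by (intro divide_right_mono add_left_mono) auto
      also have "\<dots> = 3 / 4 * e" using e by (simp add: power2_eq_square)
      also have "\<dots> < e" using e by simp
      finally show ?case .
    qed
    then show "\<exists>N. \<forall>n\<ge>N. norm ((\<integral>z. \<bar>f n z - w z\<bar> \<partial>circle_lebesgue) - 0) < e"
      by (simp add: eventually_sequentially)
  qed
  then show "(\<lambda>n. \<integral>z. \<bar>cmod (\<Prod>j<n. Q j z) - sqrt (enn2real (h z))\<bar> \<partial>circle_lebesgue) \<longlonglongrightarrow> 0"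
    by (simp add: f_def w_def)
qed


section \<open>Positive Mahler measure\<close>

lemma abs_ln_diff_le:
  fixes a :: real
  assumes a: "a > 0" "x \<ge> a" "y \<ge> a"
  shows "\<bar>ln x - ln y\<bar> \<le> (1 / a) * \<bar>x - y\<bar>"
proof -
  have le: "ln x - ln y \<le> (1 / a) * \<bar>x - y\<bar>" if "x \<ge> a" "y \<ge> a" for x y
  proof -
    have "ln x - ln y = ln (x / y)" using that a by (simp add: ln_div)
    also have "\<dots> \<le> x / y - 1" using that a by (intro ln_le_minus_one divide_pos_pos) auto
    also have "\<dots> = (x - y) / y" using that a by (simp add: field_simps)
    also have "\<dots> \<le> \<bar>x - y\<bar> / y" using that a by (intro divide_right_mono) auto
    also have "\<dots> \<le> \<bar>x - y\<bar> / a" using that a by (intro divide_left_mono) auto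
    finally show ?thesis by simp
  qed
  show ?thesis using le[OF a(2,3)] le[OF a(3,2)] by (simp add: abs_le_iff abs_minus_commute)
qed

text \<open>Only the integral of the negative part of \<open>ln h\<close> has to be bounded. Jensen's inequality bounds
  \<open>2 ln \<beta>\<close> by \<open>\<integral> \<theta> \<bar>S\<^sub>n\<bar>\<^sup>2 - 1 - ln \<theta>\<close>; the weak limit turns
  \<open>\<bar>S\<^sub>n\<bar>\<^sup>2\<close> into \<open>\<mu>\<close>, after which \<open>\<theta> = 1 / h\<close>, truncated to \<open>[1, 1 / d]\<close>, is admissible. The bound
  obtained is uniform in \<open>d\<close>.\<close>

lemma mahler_measure_pos_if_constant_terms_bounded:
  assumes p: "\<And>n. outer_poly (p n)" and \<mu>: "finite_circle_measure \<mu>" "measure \<mu> (space \<mu>) = 1"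
    and lim: "\<And>g::complex \<Rightarrow> real. continuous_on (sphere 0 1) g \<Longrightarrow>
      (\<lambda>n. \<integral>z. (cmod (poly (p n) z))\<^sup>2 * g z \<partial>circle_lebesgue) \<longlonglongrightarrow> (\<integral>z. g z \<partial>\<mu>)"
    and \<beta>: "\<beta> > 0" "\<And>n. cmod (poly (p n) 0) \<ge> \<beta>"
    and h: "is_ac_density circle_lebesgue \<mu> h"
  shows "mahler_measure h > 0"
proof -
  define g where "g z = enn2real (h z)" for z
  interpret \<mu>: finite_measure \<mu> using finite_circle_measureD[OF \<mu>(1)] by simp
  have hm[measurable]: "h \<in> borel_measurable circle_lebesgue" using h by (auto simp: is_ac_density_def)
  have gm[measurable]: "g \<in> borel_measurable circle_lebesgue" unfolding g_def by measurable
  have g0: "g z \<ge> 0" for z by (simp add: g_def)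
  have ig: "integrable circle_lebesgue g" "(\<integral>z. g z \<partial>circle_lebesgue) \<le> 1"
    using ac_density_integral_le[OF h \<mu>.finite_measure_axioms, of "\<lambda>_. 1"] \<mu>(2) by (auto simp: g_def[symmetric])
  define c where "c d z = max d (min (g z) 1)" for d z
  have cm[measurable]: "c d \<in> borel_measurable circle_lebesgue" for d unfolding c_def by measurable
  have c: "d \<le> c d z \<and> c d z \<le> 1" if "d \<le> 1" for d z using that by (auto simp: c_def)
  have lnc: "integrable circle_lebesgue (\<lambda>z. - ln (c d z))" if d: "0 < d" "d \<le> 1" for d
  proof (rule circle_lebesgue.integrable_const_bound[where B = "- ln d"])
    show "AE z in circle_lebesgue. norm (- ln (c d z)) \<le> - ln d"
    proof (rule AE_I2)
      fix z
      have "ln d \<le> ln (c d z)" "ln (c d z) \<le> 0" using c[OF d(2), of z] d by (auto simp: ln_le_zero_iff)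
      then show "norm (- ln (c d z)) \<le> - ln d" by simp
    qed
  qed measurable
  have bound: "(\<integral>z. - ln (c d z) \<partial>circle_lebesgue) \<le> 2 - 2 * ln \<beta>" if d: "0 < d" "d \<le> 1" for d
  proof -
    have cp: "c d z > 0" for z using c[OF d(2), of z] d by linarith
    have r: "1 \<le> 1 / c d z \<and> 1 / c d z \<le> 1 / d" for z
      using c[OF d(2), of z] cp[of z] d by (simp add: frac_le)
    have main: "2 * ln \<beta> \<le> 1 * measure \<mu> (space \<mu>)
        + (\<integral>z. 1 / c d z * enn2real (h z) \<partial>circle_lebesgue) + (\<integral>z. - 1 - ln (1 / c d z) \<partial>circle_lebesgue)"
    proof (rule continuous_test_inequality_extends[OF h \<mu>(1), where b = "1 / d" and L = 1 and \<theta> = "\<lambda>z. 1 / c d z"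
          and H = "\<lambda>x. - 1 - ln x"])
      show "\<bar>(- 1 - ln x) - (- 1 - ln y)\<bar> \<le> 1 * \<bar>x - y\<bar>" if "x \<in> {1..1 / d}" "y \<in> {1..1 / d}" for x y
        using abs_ln_diff_le[of 1 x y] that by (simp add: abs_minus_commute)
      show "continuous_on {1..1 / d} (\<lambda>x. - 1 - ln x)" by (intro continuous_intros) auto
      fix \<theta> :: "complex \<Rightarrow> real" assume \<theta>: "continuous_on (sphere 0 1) \<theta>" "\<And>z. 1 \<le> \<theta> z \<and> \<theta> z \<le> 1 / d"
      have \<theta>0: "\<theta> z > 0" for z using \<theta>(2)[of z] by linarith
      show "2 * ln \<beta> \<le> (\<integral>z. \<theta> z \<partial>\<mu>) + (\<integral>z. - 1 - ln (\<theta> z) \<partial>circle_lebesgue)"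
      proof (rule LIMSEQ_le_const[OF tendsto_add[OF lim[OF \<theta>(1)] tendsto_const]], intro exI allI impI)
        fix n
        have "2 * ln \<beta> \<le> 2 * ln (cmod (poly (p n) 0))" using ln_mono[OF \<beta>(2)[of n] \<beta>(1)] by simp
        also have "\<dots> \<le> (\<integral>z. \<theta> z * (cmod (poly (p n) z))\<^sup>2 \<partial>circle_lebesgue) + (\<integral>z. - 1 - ln (\<theta> z) \<partial>circle_lebesgue)"
          by (rule outer_poly_jensen[OF p \<theta>(1) \<theta>0])
        finally show "2 * ln \<beta> \<le> (\<integral>z. (cmod (poly (p n) z))\<^sup>2 * \<theta> z \<partial>circle_lebesgue) + (\<integral>z. - 1 - ln (\<theta> z) \<partial>circle_lebesgue)"
          by (simp add: mult.commute)
      qed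
    qed (use r in auto)
    have ac: "(\<integral>z. 1 / c d z * enn2real (h z) \<partial>circle_lebesgue) \<le> (\<integral>z. 1 + g z \<partial>circle_lebesgue)"
    proof -
      have pt: "1 / c d z * enn2real (h z) \<le> 1 + g z" for z
      proof (cases "g z \<le> 1")
        case True
        then have "g z \<le> c d z" by (simp add: c_def)
        then have "1 / c d z * g z \<le> 1" using cp[of z] by simp
        then show ?thesis using g0[of z] by (simp add: g_def[symmetric])
      next
        case False
        then have "c d z = 1" using d by (simp add: c_def)
        then show ?thesis by (simp add: g_def)
      qed
      have i: "integrable circle_lebesgue (\<lambda>z. 1 + g z)" using ig by simp
      show ?thesis
      proof (rule integral_mono[OF _ i pt], rule Bochner_Integration.integrable_bound[OF i])
        show "AE z in circle_lebesgue. norm (1 / c d z * enn2real (h z)) \<le> norm (1 + g z)"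
        proof (rule AE_I2)
          fix z
          have "0 \<le> 1 / c d z * enn2real (h z)" using cp[of z] by simp
          then show "norm (1 / c d z * enn2real (h z)) \<le> norm (1 + g z)" using pt[of z] by simp
        qed
      qed measurable
    qed
    have 1: "(\<integral>z. 1 + g z \<partial>circle_lebesgue) = 1 + (\<integral>z. g z \<partial>circle_lebesgue)" using ig by simp
    have "(\<integral>z. - 1 - ln (1 / c d z) \<partial>circle_lebesgue) = (\<integral>z. - 1 - (- ln (c d z)) \<partial>circle_lebesgue)"
    proof -
      have "ln (1 / c d z) = - ln (c d z)" for z using cp[of z] by (simp add: ln_div)
      then show ?thesis by simp
    qed
    also have "\<dots> = - 1 - (\<integral>z. - ln (c d z) \<partial>circle_lebesgue)"
      using lnc[OF d] by (subst Bochner_Integration.integral_diff) auto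
    finally show ?thesis using main ac 1 ig(2) \<mu>(2) by simp
  qed
  define d where "d k = 1 / real (Suc k)" for k
  have d: "0 < d k" "d k \<le> 1" for k by (auto simp: d_def)
  have ddec: "d (Suc k) \<le> d k" for k by (simp add: d_def frac_le)
  have inc: "incseq (\<lambda>k z. ennreal (- ln (c (d k) z)))"
  proof (intro incseq_SucI le_funI ennreal_leI)
    fix k z
    have "c (d (Suc k)) z \<le> c (d k) z" using ddec[of k] by (auto simp: c_def)
    moreover have "c (d (Suc k)) z > 0" using c[OF d(2), of "Suc k" z] d(1)[of "Suc k"] by linarith
    ultimately show "- ln (c (d k) z) \<le> - ln (c (d (Suc k)) z)" by simp
  qed
  have "(\<integral>\<^sup>+z. e2ennreal (- ext_ln (h z)) \<partial>circle_lebesgue)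
      \<le> (\<integral>\<^sup>+z. (SUP k. ennreal (- ln (c (d k) z))) \<partial>circle_lebesgue)"
  proof (rule nn_integral_mono)
    fix z
    consider "h z = \<infinity>" | "h z = 0" | r where "h z = ennreal r" "r \<ge> 1" | r where "h z = ennreal r" "0 < r" "r < 1"
    proof (cases "h z")
      case (real r)
      then show ?thesis using that(2-4) by (cases "r = 0"; cases "r \<ge> 1") auto
    qed (use that(1) in simp)
    then show "e2ennreal (- ext_ln (h z)) \<le> (SUP k. ennreal (- ln (c (d k) z)))"
    proof cases
      case 1
      then show ?thesis by (simp add: ext_ln_def e2ennreal_neg)
    next
      case 2
      have "(SUP k. ennreal (- ln (c (d k) z))) = top"
      proof (rule ennreal_SUP_eq_top)
        fix m :: nat
        obtain k :: nat where k: "real k \<ge> exp (real m)" using real_arch_simple by blast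
        have "c (d k) z = d k" using 2 d[of k] by (simp add: c_def g_def)
        then have "- ln (c (d k) z) = ln (real (Suc k))" by (simp add: d_def ln_div)
        moreover have "real m \<le> ln (real (Suc k))" using k by (subst ln_ge_iff) auto
        ultimately have "of_nat m \<le> ennreal (- ln (c (d k) z))"
          by (simp add: ennreal_of_nat_eq_real_of_nat ennreal_leI)
        then show "\<exists>k\<in>UNIV. of_nat m \<le> ennreal (- ln (c (d k) z))" by blast
      qed
      then show ?thesis by (simp only: top_greatest)
    next
      case (3 r)
      then have "- ext_ln (h z) \<le> 0" by (simp add: ext_ln_def ennreal_eq_0_iff)
      then show ?thesis by (simp add: e2ennreal_neg)
    next
      case (4 r)
      obtain k :: nat where "real k \<ge> 1 / r" using real_arch_simple by blast
      then have "1 / r \<le> real (Suc k)" by simp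
      then have "d k \<le> r" using 4 by (simp add: d_def field_simps)
      then have "c (d k) z = r" using 4 by (simp add: c_def g_def max_absorb2)
      moreover have "e2ennreal (- ext_ln (h z)) = ennreal (- ln r)"
        using 4 by (simp add: ext_ln_def ennreal_eq_0_iff e2ennreal_ereal)
      ultimately have "e2ennreal (- ext_ln (h z)) = ennreal (- ln (c (d k) z))" by simp
      then show ?thesis
        using SUP_upper[of k UNIV "\<lambda>k. ennreal (- ln (c (d k) z))"] by (simp only: UNIV_I)
    qed
  qed
  also have "\<dots> = (SUP k. \<integral>\<^sup>+z. ennreal (- ln (c (d k) z)) \<partial>circle_lebesgue)"
    by (rule nn_integral_monotone_convergence_SUP[OF inc]) measurable
  also have "\<dots> \<le> ennreal (2 - 2 * ln \<beta>)"
  proof (rule SUP_least)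
    fix k
    have "(\<integral>\<^sup>+z. ennreal (- ln (c (d k) z)) \<partial>circle_lebesgue) = ennreal (\<integral>z. - ln (c (d k) z) \<partial>circle_lebesgue)"
    proof (rule nn_integral_eq_integral[OF lnc[OF d]], rule AE_I2)
      fix z show "0 \<le> - ln (c (d k) z)"
        using c[OF d(2), of k z] d(1)[of k] by (simp add: ln_le_zero_iff)
    qed
    then show "(\<integral>\<^sup>+z. ennreal (- ln (c (d k) z)) \<partial>circle_lebesgue) \<le> ennreal (2 - 2 * ln \<beta>)"
      using bound[OF d] by (simp add: ennreal_leI)
  qed
  finally have neg: "(\<integral>\<^sup>+z. e2ennreal (- ext_ln (h z)) \<partial>circle_lebesgue) < \<infinity>"
    by (simp add: le_less_trans)
  have "ext_integral circle_lebesgue (\<lambda>z. ext_ln (h z)) \<noteq> - \<infinity>"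
  proof -
    have "enn2ereal X - enn2ereal Y \<noteq> - \<infinity>" if "Y < \<infinity>" for X Y
      using that by (cases X; cases Y) auto
    from this[OF neg] show ?thesis unfolding ext_integral_def .
  qed
  then show ?thesis
    unfolding mahler_measure_def by (cases "ext_integral circle_lebesgue (\<lambda>z. ext_ln (h z))") (auto simp: ext_exp_def)
qed

section \<open>Outer polynomials with small constant term\<close>

lemma cmod_coeff_le_1:
  assumes "(\<integral>z. (cmod (poly p z))\<^sup>2 \<partial>circle_lebesgue) = 1"
  shows "cmod (coeff p k) \<le> 1"
proof -
  have i: "integrable circle_lebesgue (\<lambda>z. cmod (poly p z))" "integrable circle_lebesgue (\<lambda>z. (cmod (poly p z))\<^sup>2)"
    by (intro circle_integrable continuous_intros)+
  have "coeff p k = (\<integral>z. poly p z * z powi (- int k) \<partial>circle_lebesgue)"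
    by (simp add: integral_circle_poly_powi)
  then have "cmod (coeff p k) \<le> (\<integral>z. cmod (poly p z * z powi (- int k)) \<partial>circle_lebesgue)"
    by (simp only: integral_norm_bound)
  also have "\<dots> = (\<integral>z. cmod (poly p z) \<partial>circle_lebesgue)"
    by (intro Bochner_Integration.integral_cong) (auto simp: space_circle_lebesgue norm_mult norm_power_int)
  also have "\<dots> \<le> (\<integral>z. ((cmod (poly p z))\<^sup>2 + 1) / 2 \<partial>circle_lebesgue)"
  proof (rule integral_mono)
    show "cmod (poly p z) \<le> ((cmod (poly p z))\<^sup>2 + 1) / 2" for z
      using sum_squares_bound[of "cmod (poly p z)" 1] by simp
  qed (use i in auto)
  also have "\<dots> = 1" using i assms by simp
  finally show ?thesis .
qed

text \<open>A bounded sequence in the Hardy space \<open>H\<^sup>2\<close> is a normal family in the disc. A locally uniform limit of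
  zero-free functions that vanishes at \<open>0\<close> vanishes identically, by Hurwitz' theorem, and then so do
  the limits of all Taylor coefficients.\<close>

lemma outer_poly_coeffs_tendsto_0:
  assumes p: "\<And>n. outer_poly (p n)"
    and 1: "\<And>n. (\<integral>z. (cmod (poly (p n) z))\<^sup>2 \<partial>circle_lebesgue) = 1"
    and 0: "(\<lambda>n. poly (p n) 0) \<longlonglongrightarrow> 0"
  obtains s :: "nat \<Rightarrow> nat" where "strict_mono s" "\<And>k. (\<lambda>n. coeff (p (s n)) k) \<longlonglongrightarrow> 0"
proof -
  note coeff = cmod_coeff_le_1[OF 1]
  have bd: "\<exists>B. \<forall>f\<in>range (\<lambda>n. poly (p n)). \<forall>z\<in>K. cmod (f z) \<le> B" if K: "compact K" "K \<subseteq> ball 0 1" for K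
  proof (cases "K = {}")
    case False
    obtain x where x: "x \<in> K" "\<And>z. z \<in> K \<Longrightarrow> cmod z \<le> cmod x"
      using continuous_attains_sup[OF K(1) False, of cmod] continuous_on_norm_id by blast
    define r where "r = cmod x"
    have r: "0 \<le> r" "r < 1" using x(1) K(2) by (auto simp: r_def)
    have "cmod (poly (p n) z) \<le> 1 / (1 - r)" if "z \<in> K" for n z
    proof -
      have "cmod (poly (p n) z) \<le> (\<Sum>i\<le>degree (p n). cmod (coeff (p n) i * z ^ i))"
        unfolding poly_altdef by (rule norm_sum)
      also have "\<dots> \<le> (\<Sum>i\<le>degree (p n). 1 * r ^ i)"
        unfolding norm_mult norm_power
        by (intro sum_mono mult_mono coeff power_mono) (use x(2)[OF that] in \<open>auto simp: r_def\<close>)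
      also have "\<dots> = (1 - r ^ Suc (degree (p n))) / (1 - r)"
        using r by (simp add: sum_gp0)
      also have "\<dots> \<le> 1 / (1 - r)" using r by (intro divide_right_mono) auto
      finally show ?thesis .
    qed
    then show ?thesis by blast
  qed auto
  have hol: "\<And>f. f \<in> range (\<lambda>n. poly (p n)) \<Longrightarrow> f holomorphic_on ball 0 1"
    by (auto intro!: holomorphic_intros)
  obtain g s where g: "g holomorphic_on ball 0 1" and s: "strict_mono (s :: nat \<Rightarrow> nat)"
    and lim: "\<And>x. x \<in> ball 0 1 \<Longrightarrow> (\<lambda>n. poly (p (s n)) x) \<longlonglongrightarrow> g x"
    and ul: "\<And>K. compact K \<Longrightarrow> K \<subseteq> ball 0 1 \<Longrightarrow> uniform_limit K ((\<lambda>n. poly (p n)) \<circ> s) g sequentially"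
    by (rule Montel[OF open_ball hol bd order_refl]) (assumption+, rule that)
  have g0: "g 0 = 0"
  proof (rule LIMSEQ_unique)
    show "(\<lambda>n. poly (p (s n)) 0) \<longlonglongrightarrow> g 0" by (rule lim) simp
    show "(\<lambda>n. poly (p (s n)) 0) \<longlonglongrightarrow> 0"
      using LIMSEQ_subseq_LIMSEQ[OF 0 s] by (simp add: o_def)
  qed
  have const: "g constant_on ball 0 1"
  proof (rule ccontr)
    assume nonconst: "\<not> g constant_on ball 0 1"
    have "g 0 \<noteq> 0"
    proof (rule Hurwitz_no_zeros[OF open_ball connected_ball _ g ul nonconst])
      show "((\<lambda>n. poly (p n)) \<circ> s) n holomorphic_on ball 0 1" for n by (auto intro!: holomorphic_intros)
      show "((\<lambda>n. poly (p n)) \<circ> s) n z \<noteq> 0" if "z \<in> ball 0 1" for n z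
        using p[of "s n"] that by (simp add: outer_poly_def)
    qed auto
    with g0 show False by simp
  qed
  have gz: "g z = 0" if "z \<in> ball 0 1" for z
  proof -
    obtain y where "\<And>x. x \<in> ball 0 1 \<Longrightarrow> g x = y" using const by (auto simp: constant_on_def)
    then show ?thesis using that g0 by (metis centre_in_ball zero_less_one)
  qed
  \<comment> \<open>The coefficients are recovered on the circle of radius \<open>1/2\<close>, where the convergence is uniform.\<close>
  have "(\<lambda>n. coeff (p (s n)) k) \<longlonglongrightarrow> 0" for k
  proof -
    have eq: "poly (pcompose q [:0, 1/2:]) z = poly q (z / 2)" for q :: "complex poly" and z
      by (simp add: poly_pcompose)
    have ck: "coeff (pcompose q [:0, 1/2:]) k = coeff q k / 2 ^ k" for q :: "complex poly"
      by (simp add: coeff_pcompose_linear power_divide)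
    have u: "uniform_limit (cball 0 (1/2)) (\<lambda>n. poly (p (s n))) g sequentially"
      using ul[of "cball 0 (1/2)"] by (simp add: o_def subset_iff dist_norm)
    show ?thesis
    proof (rule LIMSEQ_I)
      fix e :: real assume e: "e > 0"
      then have "e / 2 ^ Suc k > 0" by simp
      from uniform_limitD[OF u this] obtain N where
        "\<forall>n\<ge>N. \<forall>z\<in>cball 0 (1/2). dist (poly (p (s n)) z) (g z) < e / 2 ^ Suc k"
        unfolding eventually_sequentially by blast
      then have N: "dist (poly (p (s n)) z) (g z) < e / 2 ^ Suc k" if "n \<ge> N" "z \<in> cball 0 (1/2)" for n z
        using that by blast
      have "cmod (coeff (p (s n)) k) < e" if n: "n \<ge> N" for n
      proof -
        have i: "integrable circle_lebesgue (\<lambda>z. cmod (poly (p (s n)) (z / 2)))"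
          by (intro circle_integrable continuous_intros) auto
        have "coeff (p (s n)) k / 2 ^ k = (\<integral>z. poly (p (s n)) (z / 2) * z powi (- int k) \<partial>circle_lebesgue)"
          using integral_circle_poly_powi[of "pcompose (p (s n)) [:0, 1/2:]" "- int k"] by (simp add: eq ck)
        then have "cmod (coeff (p (s n)) k / 2 ^ k) \<le> (\<integral>z. cmod (poly (p (s n)) (z / 2) * z powi (- int k)) \<partial>circle_lebesgue)"
          by (simp only: integral_norm_bound)
        also have "\<dots> = (\<integral>z. cmod (poly (p (s n)) (z / 2)) \<partial>circle_lebesgue)"
          by (intro Bochner_Integration.integral_cong) (auto simp: space_circle_lebesgue norm_mult norm_power_int)
        also have "\<dots> \<le> (\<integral>z. e / 2 ^ Suc k \<partial>circle_lebesgue)"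
        proof (rule integral_mono[OF i])
          fix z assume "z \<in> space circle_lebesgue"
          then have "cmod z = 1" by (simp add: space_circle_lebesgue)
          then have "z / 2 \<in> cball 0 (1/2)" "z / 2 \<in> ball 0 1" by (simp_all add: norm_divide)
          then show "cmod (poly (p (s n)) (z / 2)) \<le> e / 2 ^ Suc k"
            using N[OF n, of "z / 2"] gz[of "z / 2"] by (simp add: dist_norm)
        qed simp
        also have "\<dots> = e / 2 ^ Suc k" by simp
        finally show ?thesis using e by (simp add: norm_divide norm_power field_simps)
      qed
      then show "\<exists>N. \<forall>n\<ge>N. norm (coeff (p (s n)) k - 0) < e" by auto
    qed
  qed
  with s show ?thesis by (rule that)
qed

section \<open>Uniqueness of Fourier coefficients\<close>

lemma integrable_circle_times_powi:
  assumes "integrable circle_lebesgue F"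
  shows "integrable circle_lebesgue (\<lambda>z. F z * z powi k)"
proof (rule Bochner_Integration.integrable_bound[OF assms])
  have "continuous_on (sphere 0 1) (\<lambda>z::complex. z powi k)" by (intro continuous_intros) auto
  from circle_integrable[OF this]
  have "(\<lambda>z::complex. z powi k) \<in> borel_measurable circle_lebesgue" by auto
  then show "(\<lambda>z. F z * z powi k) \<in> borel_measurable circle_lebesgue" using assms by measurable
  show "AE z in circle_lebesgue. norm (F z * z powi k) \<le> norm (F z)"
    by (rule AE_I2) (auto simp: norm_mult norm_power_int space_circle_lebesgue)
qed

text \<open>On the circle, the coordinate functions are combinations of \<open>z\<close> and \<open>z powi (-1)\<close>, so that functions with vanishing
  Fourier coefficients are stable under multiplication by real polynomials.\<close>

lemma real_polynomial_function_preserves_zero_fourier_coeffs: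
  fixes q :: "complex \<Rightarrow> real" and F :: "complex \<Rightarrow> complex"
  assumes "real_polynomial_function q" "integrable circle_lebesgue F"
    "\<And>k. (\<integral>z. F z * z powi k \<partial>circle_lebesgue) = 0"
  shows "integrable circle_lebesgue (\<lambda>z. F z * of_real (q z)) \<and>
    (\<forall>k. (\<integral>z. F z * of_real (q z) * z powi k \<partial>circle_lebesgue) = 0)"
  using assms
proof (induction q arbitrary: F)
  case (linear f F)
  note ip = integrable_circle_times_powi[OF linear(2)]
  define a where "a = (of_real (f 1) - \<i> * of_real (f \<i>)) / 2"
  define b where "b = (of_real (f 1) + \<i> * of_real (f \<i>)) / 2"
  have f: "of_real (f z) = a * z + b * z powi (- 1)" if z: "z \<in> space circle_lebesgue" for z
  proof -
    interpret bounded_linear f by (rule linear(1))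
    have "f z = f (Re z *\<^sub>R 1 + Im z *\<^sub>R \<i>)"
    proof -
      have "Re z *\<^sub>R 1 + Im z *\<^sub>R \<i> = z" by (simp add: complex_eq_iff)
      then show ?thesis by simp
    qed
    also have "\<dots> = Re z * f 1 + Im z * f \<i>" by (simp only: add scaleR real_scaleR_def)
    finally have "f z = Re z * f 1 + Im z * f \<i>" .
    moreover have zi: "z powi (- 1) = cnj z"
      using circle_power_eq_powi[of z 1] z by (simp add: space_circle_lebesgue)
    ultimately show ?thesis
      unfolding zi a_def b_def by (simp add: complex_eq_iff field_simps)
  qed
  have eq: "F z * of_real (f z) * z powi k = a * (F z * z powi (k + 1)) + b * (F z * z powi (k - 1))"
    if z: "z \<in> space circle_lebesgue" for z k
  proof -
    have "z \<noteq> 0" using z by (auto simp: space_circle_lebesgue)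
    then show ?thesis unfolding f[OF z]
      by (simp add: power_int_add power_int_diff power_int_minus field_simps)
  qed
  have "integrable circle_lebesgue (\<lambda>z. F z * of_real (f z) * z powi 0)"
  proof (subst Bochner_Integration.integrable_cong[OF refl eq])
    show "integrable circle_lebesgue (\<lambda>z. a * (F z * z powi (0 + 1)) + b * (F z * z powi (0 - 1)))"
      by (intro Bochner_Integration.integrable_add integrable_mult_right ip)
  qed
  moreover have "(\<integral>z. F z * of_real (f z) * z powi k \<partial>circle_lebesgue) = 0" for k
    by (subst Bochner_Integration.integral_cong[OF refl eq]) (use ip linear(3) in auto)
  ultimately show ?case by simp
next
  case (const c F)
  have "(\<integral>z. F z * of_real c * z powi k \<partial>circle_lebesgue) = (\<integral>z. of_real c * (F z * z powi k) \<partial>circle_lebesgue)" for k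
    by (simp add: ac_simps)
  then show ?case using const by simp
next
  case (add f g F)
  have f: "integrable circle_lebesgue (\<lambda>z. F z * of_real (f z))" "\<And>k. (\<integral>z. F z * of_real (f z) * z powi k \<partial>circle_lebesgue) = 0"
    using add.IH(1)[OF add.prems] by auto
  have g: "integrable circle_lebesgue (\<lambda>z. F z * of_real (g z))" "\<And>k. (\<integral>z. F z * of_real (g z) * z powi k \<partial>circle_lebesgue) = 0"
    using add.IH(2)[OF add.prems] by auto
  show ?case
  proof (intro conjI allI)
    show "integrable circle_lebesgue (\<lambda>z. F z * of_real (f z + g z))"
      using Bochner_Integration.integrable_add[OF f(1) g(1)] by (simp add: distrib_left)
    fix k
    have "(\<integral>z. F z * of_real (f z + g z) * z powi k \<partial>circle_lebesgue)
        = (\<integral>z. F z * of_real (f z) * z powi k + F z * of_real (g z) * z powi k \<partial>circle_lebesgue)"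
      by (simp add: algebra_simps)
    also have "\<dots> = 0"
      using Bochner_Integration.integral_add[OF integrable_circle_times_powi[OF f(1)] integrable_circle_times_powi[OF g(1)]] f(2) g(2) by simp
    finally show "(\<integral>z. F z * of_real (f z + g z) * z powi k \<partial>circle_lebesgue) = 0" .
  qed
next
  case (mult f g F)
  have f: "integrable circle_lebesgue (\<lambda>z. F z * of_real (f z))" "\<And>k. (\<integral>z. F z * of_real (f z) * z powi k \<partial>circle_lebesgue) = 0"
    using mult.IH(1)[OF mult.prems] by auto
  from mult.IH(2)[OF this] show ?case by (simp add: mult.assoc)
qed

text \<open>The sign of \<open>f\<close>, for which the integral would be \<open>\<integral> \<bar>f\<bar>\<close>, is not continuous. It is approximated in
  \<open>L\<^sup>1\<close> of the measure with density \<open>\<bar>f\<bar>\<close>, which is the weight that the error carries.\<close>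

lemma AE_zero_if_continuous_integrals_zero:
  fixes f :: "complex \<Rightarrow> real"
  assumes f: "integrable circle_lebesgue f"
    and 0: "\<And>\<theta>::complex \<Rightarrow> real. continuous_on (sphere 0 1) \<theta> \<Longrightarrow> (\<integral>z. f z * \<theta> z \<partial>circle_lebesgue) = 0"
  shows "AE z in circle_lebesgue. f z = 0"
proof -
  define T where "T = density circle_lebesgue (\<lambda>z. ennreal \<bar>f z\<bar>)"
  have fm[measurable]: "f \<in> borel_measurable circle_lebesgue" using f by auto
  have "emeasure T (space T) = (\<integral>\<^sup>+z. ennreal \<bar>f z\<bar> \<partial>circle_lebesgue)"
    unfolding T_def by (simp add: emeasure_density cong: nn_integral_cong)
  also have "\<dots> < \<infinity>" using f by (simp add: integrable_iff_bounded)
  finally have T: "finite_circle_measure T"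
    unfolding finite_circle_measure_def
    by (intro conjI finite_measureI) (auto simp: T_def sets_circle_lebesgue)
  have intT: "(\<integral>z. g z \<partial>T) = (\<integral>z. \<bar>f z\<bar> * g z \<partial>circle_lebesgue)"
    if "g \<in> borel_measurable circle_lebesgue" for g :: "complex \<Rightarrow> real"
    unfolding T_def using integral_density[OF that, of "\<lambda>z. \<bar>f z\<bar>"] by simp
  have sm: "(\<lambda>z. sgn (f z)) \<in> borel_measurable circle_lebesgue" by measurable
  have "(\<integral>z. \<bar>f z\<bar> \<partial>circle_lebesgue) \<le> 0"
  proof (rule field_le_epsilon)
    fix e :: real assume e: "e > 0"
    have sr: "- 1 \<le> sgn (f z) \<and> sgn (f z) \<le> 1" for z by (simp add: sgn_if)
    obtain t :: "complex \<Rightarrow> real" where t: "continuous_on (sphere 0 1) t" "\<And>z. - 1 \<le> t z \<and> t z \<le> 1"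
      "(\<integral>z. \<bar>sgn (f z) - t z\<bar> \<partial>T) < e" "(\<integral>z. \<bar>sgn (f z) - t z\<bar> \<partial>T) < e"
      by (rule circle_L1_approx_continuous[OF T T sm sr e]) (rule that)
    have tm[measurable]: "t \<in> borel_measurable circle_lebesgue" using circle_integrable[OF t(1)] by auto
    have it: "integrable circle_lebesgue (\<lambda>z. f z * t z)"
      by (rule Bochner_Integration.integrable_bound[OF f])
        (use t(2) in \<open>auto simp: abs_mult abs_le_iff intro!: AE_I2 mult_left_le\<close>)
    have ia: "integrable circle_lebesgue (\<lambda>z. \<bar>f z\<bar>)" using f by simp
    have ib: "integrable circle_lebesgue (\<lambda>z. \<bar>f z\<bar> * \<bar>sgn (f z) - t z\<bar>)"
    proof (rule Bochner_Integration.integrable_bound[of _ "\<lambda>z. 2 * \<bar>f z\<bar>"])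
      show "AE z in circle_lebesgue. norm (\<bar>f z\<bar> * \<bar>sgn (f z) - t z\<bar>) \<le> norm (2 * \<bar>f z\<bar>)"
      proof (rule AE_I2)
        fix z
        have "\<bar>sgn (f z) - t z\<bar> \<le> 2" using sr[of z] t(2)[of z] by linarith
        from mult_left_mono[OF this abs_ge_zero[of "f z"]]
        show "norm (\<bar>f z\<bar> * \<bar>sgn (f z) - t z\<bar>) \<le> norm (2 * \<bar>f z\<bar>)" by (simp add: abs_mult mult.commute)
      qed
    qed (use ia in auto)
    have "(\<integral>z. \<bar>f z\<bar> \<partial>circle_lebesgue) = (\<integral>z. \<bar>f z\<bar> \<partial>circle_lebesgue) - (\<integral>z. f z * t z \<partial>circle_lebesgue)"
      using 0[OF t(1)] by simp
    also have "\<dots> = (\<integral>z. \<bar>f z\<bar> - f z * t z \<partial>circle_lebesgue)" using it ia by simp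
    also have "\<dots> \<le> (\<integral>z. \<bar>f z\<bar> * \<bar>sgn (f z) - t z\<bar> \<partial>circle_lebesgue)"
    proof (rule integral_mono[OF _ ib])
      fix z
      have "\<bar>f z\<bar> - f z * t z = f z * (sgn (f z) - t z)" by (simp add: algebra_simps abs_sgn mult.commute)
      also have "\<dots> \<le> \<bar>f z\<bar> * \<bar>sgn (f z) - t z\<bar>" by (simp only: abs_mult[symmetric] abs_ge_self)
      finally show "\<bar>f z\<bar> - f z * t z \<le> \<bar>f z\<bar> * \<bar>sgn (f z) - t z\<bar>" .
    qed (use it ia in auto)
    also have "\<dots> = (\<integral>z. \<bar>sgn (f z) - t z\<bar> \<partial>T)" by (rule intT[symmetric]) measurable
    finally show "(\<integral>z. \<bar>f z\<bar> \<partial>circle_lebesgue) \<le> 0 + e" using t(3) by simp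
  qed
  then have "(\<integral>z. \<bar>f z\<bar> \<partial>circle_lebesgue) = 0"
    by (intro antisym Bochner_Integration.integral_nonneg) auto
  then show ?thesis
    using f by (subst (asm) integral_nonneg_eq_0_iff_AE) auto
qed

lemma AE_zero_if_fourier_coeffs_zero:
  assumes F: "integrable circle_lebesgue F" and 0: "\<And>k. (\<integral>z. F z * z powi k \<partial>circle_lebesgue) = 0"
  shows "AE z in circle_lebesgue. F z = 0"
proof -
  have cont0: "(\<integral>z. F z * of_real (\<theta> z) \<partial>circle_lebesgue) = 0" and icont: "integrable circle_lebesgue (\<lambda>z. F z * of_real (\<theta> z))"
    if \<theta>: "continuous_on (sphere 0 1) \<theta>" for \<theta> :: "complex \<Rightarrow> real"
  proof -
    have "compact (\<theta> ` sphere 0 1)" using \<theta> by (intro compact_continuous_image) auto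
    then obtain B where B: "\<And>z. z \<in> sphere 0 1 \<Longrightarrow> \<bar>\<theta> z\<bar> \<le> B"
      using compact_imp_bounded bounded_iff by (metis image_eqI real_norm_def)
    have \<theta>m[measurable]: "\<theta> \<in> borel_measurable circle_lebesgue" using circle_integrable[OF \<theta>] by auto
    show i: "integrable circle_lebesgue (\<lambda>z. F z * of_real (\<theta> z))"
    proof (rule Bochner_Integration.integrable_bound[of _ "\<lambda>z. B *\<^sub>R F z"])
      show "AE z in circle_lebesgue. norm (F z * of_real (\<theta> z)) \<le> norm (B *\<^sub>R F z)"
        using B by (intro AE_I2) (auto simp: space_circle_lebesgue norm_mult mult.commute
            intro!: mult_right_mono intro: order_trans[OF _ abs_ge_self])
    qed (use F in auto)
    show "(\<integral>z. F z * of_real (\<theta> z) \<partial>circle_lebesgue) = 0"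
    proof -
      define I where "I = (\<integral>z. norm (F z) \<partial>circle_lebesgue)"
      have I: "I \<ge> 0" unfolding I_def by (intro Bochner_Integration.integral_nonneg) simp
      have "norm (\<integral>z. F z * of_real (\<theta> z) \<partial>circle_lebesgue) \<le> 0"
      proof (rule field_le_epsilon)
        fix e :: real assume e: "e > 0"
        then have e': "e / (I + 1) > 0" using I by simp
        obtain q where q: "real_polynomial_function q" "\<And>z. z \<in> sphere 0 1 \<Longrightarrow> \<bar>\<theta> z - q z\<bar> < e / (I + 1)"
          by (rule Stone_Weierstrass_real_polynomial_function[OF compact_sphere \<theta> e']) (rule that)
        note Fq = real_polynomial_function_preserves_zero_fourier_coeffs[OF q(1) F 0]
        have Fq0: "(\<integral>z. F z * of_real (q z) \<partial>circle_lebesgue) = 0"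
          using conjunct2[OF Fq, rule_format, of 0] by simp
        have "(\<integral>z. F z * of_real (\<theta> z) \<partial>circle_lebesgue) = (\<integral>z. F z * of_real (\<theta> z) - F z * of_real (q z) \<partial>circle_lebesgue)"
          using i Fq Fq0 by simp
        then have "norm (\<integral>z. F z * of_real (\<theta> z) \<partial>circle_lebesgue)
            \<le> (\<integral>z. norm (F z * of_real (\<theta> z) - F z * of_real (q z)) \<partial>circle_lebesgue)"
          by (simp only: integral_norm_bound)
        also have "\<dots> \<le> (\<integral>z. norm (F z) * (e / (I + 1)) \<partial>circle_lebesgue)"
        proof (rule integral_mono)
          fix z assume "z \<in> space circle_lebesgue"
          then have "\<bar>\<theta> z - q z\<bar> \<le> e / (I + 1)" using q(2)[of z] by (simp add: space_circle_lebesgue less_imp_le)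
          moreover have "F z * of_real (\<theta> z) - F z * of_real (q z) = F z * of_real (\<theta> z - q z)"
            by (simp add: right_diff_distrib)
          then have "norm (F z * of_real (\<theta> z) - F z * of_real (q z)) = norm (F z) * \<bar>\<theta> z - q z\<bar>"
            by (simp only: norm_mult norm_of_real)
          ultimately show "norm (F z * of_real (\<theta> z) - F z * of_real (q z)) \<le> norm (F z) * (e / (I + 1))"
            by (simp only: mult_left_mono norm_ge_zero)
        qed (use i Fq F in auto)
        also have "\<dots> = I * (e / (I + 1))" by (simp add: I_def)
        also have "\<dots> \<le> e" using I e by (simp add: field_simps)
        finally show "norm (\<integral>z. F z * of_real (\<theta> z) \<partial>circle_lebesgue) \<le> 0 + e" by simp
      qed
      then show ?thesis by simp
    qed
  qed
  have "AE z in circle_lebesgue. Re (F z) = 0"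
  proof (rule AE_zero_if_continuous_integrals_zero)
    fix \<theta> :: "complex \<Rightarrow> real" assume \<theta>: "continuous_on (sphere 0 1) \<theta>"
    have "(\<integral>z. Re (F z * of_real (\<theta> z)) \<partial>circle_lebesgue) = 0"
      using integral_Re[OF icont[OF \<theta>]] cont0[OF \<theta>] by simp
    then show "(\<integral>z. Re (F z) * \<theta> z \<partial>circle_lebesgue) = 0" by simp
  qed (use F in auto)
  moreover have "AE z in circle_lebesgue. Im (F z) = 0"
  proof (rule AE_zero_if_continuous_integrals_zero)
    fix \<theta> :: "complex \<Rightarrow> real" assume \<theta>: "continuous_on (sphere 0 1) \<theta>"
    have "(\<integral>z. Im (F z * of_real (\<theta> z)) \<partial>circle_lebesgue) = 0"
      using integral_Im[OF icont[OF \<theta>]] cont0[OF \<theta>] by simp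
    then show "(\<integral>z. Im (F z) * \<theta> z \<partial>circle_lebesgue) = 0" by simp
  qed (use F in auto)
  ultimately show ?thesis by eventually_elim (simp add: complex_eq_iff)
qed


section \<open>The dichotomy\<close>

lemma phase_mult_norm: "phase P n z * of_real (cmod (\<Prod>j<n. poly (P j) z)) = (\<Prod>j<n. poly (P j) z)"
proof -
  have "x / of_real (cmod x) * of_real (cmod x) = x" for x :: complex by (cases "x = 0") auto
  then show ?thesis unfolding phase_def .
qed

lemma cmod_phase_le_1: "cmod (phase P n z) \<le> 1"
proof -
  have "cmod (x / of_real (cmod x)) \<le> 1" for x :: complex by (cases "x = 0") (auto simp: norm_divide)
  then show ?thesis unfolding phase_def .
qed

text \<open>With \<open>S\<close> the partial product, \<open>S = phase \<cdot> \<bar>S\<bar>\<close> and \<open>\<bar>S\<bar>\<close> tends to \<open>w\<close> in mean, so the weak-star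
  limit of the phases gives \<open>\<phi> w\<close> as limit of \<open>S\<close> in the sense of Fourier coefficients.\<close>

lemma phase_limit_fourier_coeff:
  fixes P :: "nat \<Rightarrow> complex poly"
  assumes \<phi>: "weak_star_converges circle_lebesgue (\<lambda>n. phase P (t n)) \<phi>"
    and w: "integrable circle_lebesgue w"
    and lim: "(\<lambda>n. \<integral>z. \<bar>cmod (\<Prod>j<t n. poly (P j) z) - w z\<bar> \<partial>circle_lebesgue) \<longlonglongrightarrow> 0"
    and c: "(\<lambda>n. \<integral>z. (\<Prod>j<t n. poly (P j) z) * z powi k \<partial>circle_lebesgue) \<longlonglongrightarrow> 0"
  shows "(\<integral>z. \<phi> z * of_real (w z) * z powi k \<partial>circle_lebesgue) = 0"
proof -
  define S where "S n z = (\<Prod>j<t n. poly (P j) z)" for n z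
  have Sc: "continuous_on (sphere 0 1) (S n)" for n unfolding S_def by (intro continuous_intros)
  have pm[measurable]: "phase P (t n) \<in> borel_measurable circle_lebesgue" for n
    using \<phi> by (auto simp: weak_star_converges_def in_Linfty_def)
  have iS: "integrable circle_lebesgue (S n)" for n by (rule circle_integrable[OF Sc])
  have iw: "integrable circle_lebesgue (\<lambda>z. of_real (w z) :: complex)" using w by simp
  have ipw: "integrable circle_lebesgue (\<lambda>z. phase P (t n) z * of_real (w z))" for n
  proof (rule Bochner_Integration.integrable_bound[OF iw])
    show "AE z in circle_lebesgue. norm (phase P (t n) z * of_real (w z)) \<le> norm (of_real (w z) :: complex)"
      using cmod_phase_le_1[of P "t n"] by (intro AE_I2) (auto simp: norm_mult intro!: mult_left_le_one_le)
  qed (use iw in measurable)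
  have dist: "norm ((\<integral>z. phase P (t n) z * (of_real (w z) * z powi k) \<partial>circle_lebesgue) - (\<integral>z. S n z * z powi k \<partial>circle_lebesgue))
      \<le> (\<integral>z. \<bar>cmod (S n z) - w z\<bar> \<partial>circle_lebesgue)" for n
  proof -
    have "(\<integral>z. phase P (t n) z * (of_real (w z) * z powi k) \<partial>circle_lebesgue) - (\<integral>z. S n z * z powi k \<partial>circle_lebesgue)
        = (\<integral>z. phase P (t n) z * of_real (w z) * z powi k - S n z * z powi k \<partial>circle_lebesgue)"
      using integrable_circle_times_powi[OF ipw] integrable_circle_times_powi[OF iS] by (simp add: mult.assoc)
    then have "norm ((\<integral>z. phase P (t n) z * (of_real (w z) * z powi k) \<partial>circle_lebesgue) - (\<integral>z. S n z * z powi k \<partial>circle_lebesgue))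
        \<le> (\<integral>z. norm (phase P (t n) z * of_real (w z) * z powi k - S n z * z powi k) \<partial>circle_lebesgue)"
      by (simp only: integral_norm_bound)
    also have "\<dots> \<le> (\<integral>z. \<bar>cmod (S n z) - w z\<bar> \<partial>circle_lebesgue)"
    proof (rule integral_mono)
      show "integrable circle_lebesgue (\<lambda>z. norm (phase P (t n) z * of_real (w z) * z powi k - S n z * z powi k))"
        using integrable_circle_times_powi[OF ipw] integrable_circle_times_powi[OF iS] by simp
      show "integrable circle_lebesgue (\<lambda>z. \<bar>cmod (S n z) - w z\<bar>)" using iS w by simp
      fix z assume "z \<in> space circle_lebesgue"
      then have z: "norm (z powi k) = 1" by (simp add: space_circle_lebesgue norm_power_int)
      have "phase P (t n) z * of_real (w z) * z powi k - S n z * z powi k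
          = phase P (t n) z * of_real (w z - cmod (S n z)) * z powi k"
        using phase_mult_norm[of P "t n" z] by (simp add: S_def algebra_simps)
      then have "norm (phase P (t n) z * of_real (w z) * z powi k - S n z * z powi k)
          = norm (phase P (t n) z) * \<bar>w z - cmod (S n z)\<bar>"
        using z by (simp only: norm_mult norm_of_real mult_1_right)
      also have "\<dots> \<le> 1 * \<bar>w z - cmod (S n z)\<bar>" by (intro mult_right_mono cmod_phase_le_1) simp
      finally show "norm (phase P (t n) z * of_real (w z) * z powi k - S n z * z powi k) \<le> \<bar>cmod (S n z) - w z\<bar>"
        by (simp add: abs_minus_commute)
    qed
    finally show ?thesis .
  qed
  have "(\<lambda>n. (\<integral>z. phase P (t n) z * (of_real (w z) * z powi k) \<partial>circle_lebesgue) - (\<integral>z. S n z * z powi k \<partial>circle_lebesgue)) \<longlonglongrightarrow> 0"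
    by (rule Lim_null_comparison[OF always_eventually lim[folded S_def]]) (use dist in blast)
  from tendsto_add[OF this c[folded S_def]]
  have "(\<lambda>n. \<integral>z. phase P (t n) z * (of_real (w z) * z powi k) \<partial>circle_lebesgue) \<longlonglongrightarrow> 0" by simp
  moreover have "(\<lambda>n. \<integral>z. phase P (t n) z * (of_real (w z) * z powi k) \<partial>circle_lebesgue)
      \<longlonglongrightarrow> (\<integral>z. \<phi> z * (of_real (w z) * z powi k) \<partial>circle_lebesgue)"
    using \<phi> integrable_circle_times_powi[OF iw] by (auto simp: weak_star_converges_def)
  ultimately have "(\<integral>z. \<phi> z * (of_real (w z) * z powi k) \<partial>circle_lebesgue) = 0"
    by (rule LIMSEQ_unique[symmetric])
  then show ?thesis by (simp add: mult.assoc)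
qed

lemma outer_poly_prod:
  fixes P :: "nat \<Rightarrow> complex poly"
  assumes "\<And>j. outer_poly (P j)" shows "outer_poly (\<Prod>j<n. P j)"
  using assms by (induction n) (auto simp: outer_poly_def)

theorem theorem5p4:
  fixes P :: "nat \<Rightarrow> complex poly"
    and \<mu> :: "complex measure"
    and h :: "complex \<Rightarrow> ennreal"
    and r :: "nat \<Rightarrow> nat"
    and \<phi> :: "complex \<Rightarrow> complex"
  assumes "generalized_riesz_product (\<lambda>j. poly (P j)) \<mu>"
    and "class_L (\<lambda>j. poly (P j))"
    and "\<And>j. positive_constant_term (P j)"
    and "\<And>j. outer_poly (P j)"
    and "is_ac_density circle_lebesgue \<mu> h"
    and "strict_mono r"
    and "weak_star_converges circle_lebesgue (\<lambda>n. phase P (r n)) \<phi>"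
    and "AE z in circle_lebesgue. h z > 0 \<longrightarrow> \<phi> z \<noteq> 0"
  shows "mutually_singular \<mu> circle_lebesgue \<or> mahler_measure h > 0"
proof -
  define S where "S n = (\<Prod>j<n. P j)" for n
  have pS: "poly (S n) z = (\<Prod>j<n. poly (P j) z)" for n z by (simp add: S_def poly_prod)
  have outer: "outer_poly (S n)" for n unfolding S_def by (rule outer_poly_prod[OF assms(4)])
  have S0: "poly (S n) 0 \<noteq> 0" for n using outer[of n] by (simp add: outer_poly_def)
  have norm1: "(\<integral>z. (cmod (\<Prod>i\<in>I. poly (P i) z))\<^sup>2 \<partial>circle_lebesgue) = 1" if "finite I" for I
    using assms(1) that by (simp add: generalized_riesz_product_def defines_generalized_riesz_product_def)
  have S1: "(\<integral>z. (cmod (poly (S n) z))\<^sup>2 \<partial>circle_lebesgue) = 1" for n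
    using norm1[of "{..<n}"] by (simp add: pS)
  have \<mu>: "is_product_measure (\<lambda>j. poly (P j)) \<mu>" using assms(1) by (simp add: generalized_riesz_product_def)
  have fc: "finite_circle_measure \<mu>" using \<mu> by (simp add: is_product_measure_def)
  have cP: "continuous_on (sphere 0 1) (poly (P j))" for j by (intro continuous_intros)
  have mass: "measure \<mu> (space \<mu>) = 1"
    using product_measure_mass[OF cP \<mu>] S1 by (simp add: pS)
  show ?thesis
  proof (cases "\<exists>\<beta>>0. \<forall>n. \<beta> \<le> cmod (poly (S n) 0)")
    case True
    then obtain \<beta> where \<beta>: "\<beta> > 0" "\<And>n. \<beta> \<le> cmod (poly (S n) 0)" by blast
    have "mahler_measure h > 0"
      using product_measure_integral_tendsto[OF cP \<mu>]
      by (intro mahler_measure_pos_if_constant_terms_bounded[OF outer fc mass _ \<beta> assms(5)]) (simp add: pS)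
    then show ?thesis ..
  next
    case False
    \<comment> \<open>The constant terms decrease, so that along every subsequence they tend to \<open>0\<close>.\<close>
    have P0: "cmod (poly (P j) 0) \<le> 1" for j
      using cmod_coeff_le_1[of "P j" 0] norm1[of "{j}"] by (simp add: poly_0_coeff_0)
    have dec: "decseq (\<lambda>n. cmod (poly (S n) 0))"
    proof (rule decseq_SucI)
      fix n
      have "cmod (poly (S (Suc n)) 0) = cmod (poly (S n) 0) * cmod (poly (P n) 0)" by (simp add: S_def norm_mult)
      also have "\<dots> \<le> cmod (poly (S n) 0)" by (rule mult_left_le[OF P0]) simp
      finally show "cmod (poly (S (Suc n)) 0) \<le> cmod (poly (S n) 0)" .
    qed
    have "(\<lambda>n. poly (S n) 0) \<longlonglongrightarrow> 0"
    proof (rule LIMSEQ_I)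
      fix e :: real assume "e > 0"
      then obtain N where "cmod (poly (S N) 0) < e" using False by (meson not_le)
      then show "\<exists>N. \<forall>n\<ge>N. norm (poly (S n) 0 - 0) < e"
        using decseqD[OF dec] by (metis diff_zero order_le_less_trans)
    qed
    from LIMSEQ_subseq_LIMSEQ[OF this assms(6)]
    have "(\<lambda>n. poly (S (r n)) 0) \<longlonglongrightarrow> 0" by (simp add: o_def)
    from outer_poly_coeffs_tendsto_0[OF outer S1 this]
    obtain s :: "nat \<Rightarrow> nat" where s: "strict_mono s" and coeff: "\<And>k. (\<lambda>n. coeff (S (r (s n))) k) \<longlonglongrightarrow> 0" by blast
    have "AE z in circle_lebesgue. (\<Prod>j<n. poly (P j) z) \<noteq> 0" for n
    proof -
      have "S n \<noteq> 0" using S0[of n] by auto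
      from AE_circle_poly_nonzero[OF this] show ?thesis by (simp only: pS)
    qed
    note mean = partial_product_converges_in_mean[OF assms(1,2,5) this]
    define w where "w z = sqrt (enn2real (h z))" for z
    define t where "t n = r (s n)" for n
    have t: "strict_mono t" using strict_mono_o[OF assms(6) s] by (simp add: o_def t_def[abs_def])
    have lim: "(\<lambda>n. \<integral>z. \<bar>cmod (\<Prod>j<t n. poly (P j) z) - w z\<bar> \<partial>circle_lebesgue) \<longlonglongrightarrow> 0"
      using LIMSEQ_subseq_LIMSEQ[OF mean(2) t] by (simp add: o_def w_def)
    have iw: "integrable circle_lebesgue w" using mean(1) by (simp add: w_def[abs_def])
    have \<phi>t: "weak_star_converges circle_lebesgue (\<lambda>n. phase P (t n)) \<phi>"
      using assms(7) LIMSEQ_subseq_LIMSEQ[OF _ s] unfolding weak_star_converges_def t_def o_def by blast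
    have c: "(\<lambda>n. \<integral>z. (\<Prod>j<t n. poly (P j) z) * z powi k \<partial>circle_lebesgue) \<longlonglongrightarrow> 0" for k
      unfolding pS[symmetric] integral_circle_poly_powi
      using coeff[of "nat (- k)"] unfolding t_def by (cases "k \<le> 0") simp_all
    have \<phi>m: "\<phi> \<in> borel_measurable circle_lebesgue" and "\<exists>C. AE z in circle_lebesgue. cmod (\<phi> z) \<le> C"
      using assms(7) by (auto simp: weak_star_converges_def in_Linfty_def)
    then obtain C where C: "AE z in circle_lebesgue. cmod (\<phi> z) \<le> C" by blast
    have "integrable circle_lebesgue (\<lambda>z. \<phi> z * of_real (w z))"
    proof (rule Bochner_Integration.integrable_bound)
      show "integrable circle_lebesgue (\<lambda>z. C * w z)" using iw by simp
      show "(\<lambda>z. \<phi> z * of_real (w z)) \<in> borel_measurable circle_lebesgue" using \<phi>m iw by measurable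
      show "AE z in circle_lebesgue. norm (\<phi> z * of_real (w z)) \<le> norm (C * w z)"
        using C
      proof eventually_elim
        case (elim z)
        then have "cmod (\<phi> z) \<le> \<bar>C\<bar>" by linarith
        then show ?case by (simp add: norm_mult abs_mult mult_right_mono)
      qed
    qed
    from AE_zero_if_fourier_coeffs_zero[OF this phase_limit_fourier_coeff[OF \<phi>t iw lim c]]
    have "AE z in circle_lebesgue. \<phi> z * of_real (w z) = 0" .
    with assms(8) have "AE z in circle_lebesgue. enn2real (h z) = 0"
    proof eventually_elim
      case (elim z)
      then show ?case by (cases "h z = 0") (auto simp: w_def zero_less_iff_neq_zero)
    qed
    then have "mutually_singular \<mu> circle_lebesgue"
      by (rule mutually_singular_if_ac_density_0[OF assms(5) finite_circle_measureD(1)[OF fc]])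
    then show ?thesis ..
  qed
qed

end
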